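(* Let $G_1,G_2$ be finite groups and $x_i\in\Omega(G_i)$ for $i=1,2$. Then $$\mathfrak n_{G_1\times G_2}\bigl(\operatorname{Prod}(x_1\otimes x_2)\bigr)=\operatorname{Prod}\bigl(\mathfrak n_{G_1}(x_1)\otimes \mathfrak n_{G_2}(x_2)\bigr).$$ Consequently, for $N_i\trianglelefteq G_i$ ($i=1,2$), $$c_{N_1\times N_2}\bigl(\operatorname{Prod}(x_1\otimes x_2)\bigr)=c_{N_1}(x_1)\,c_{N_2}(x_2)$$ and $$s_{N_1\times N_2}\bigl(\operatorname{Prod}(x_1\otimes x_2)\bigr)=s_{N_1}(x_1)\,s_{N_2}(x_2).$$
   Context: For a finite group $G$, $\Omega(G)$ is the Burnside ring (Grothendieck ring of finite $G$-sets), with $\mathbb Z$-basis $[G/H]$, $(H)$ running over the conjugacy classes of subgroups of $G$. With $\operatorname{core}_G(H)=\bigcap_{g\in G}gHg^{-1}$, for $x=\sum_{(H)}a_H[G/H]\in\Omega(G)$ and $N\trianglelefteq G$ put $c_N(x)=\sum_{(H):\,\operatorname{core}_G(H)=N}a_H$ and $s_N(x)=\sum_{N\le M\trianglelefteq G}c_M(x)$. The normal-core compression $\mathfrak n_G:\Omega(G)\to\Omega(G)$ is the additive map with $\mathfrak n_G([G/H])=[G/\operatorname{core}_G(H)]$. $\operatorname{Prod}:\Omega(G_1)\otimes_{\mathbb Z}\Omega(G_2)\to\Omega(G_1\times G_2)$ is the ring homomorphism given by linear extension of $[G_1/H_1]\otimes[G_2/H_2]\mapsto[(G_1\times G_2)/(H_1\times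 H_2)]$. On the left-hand sides, core coefficients are taken in $G_1\times G_2$; on the right-hand sides, in $G_1$ and $G_2$ respectively. *)

theory Defs
  imports "HOL-Algebra.Algebra"
begin

section \<open>Finite \<open>G\<close>-sets up to isomorphism\<close>

definition finite_gset ::
    "('a, 'm) monoid_scheme \<Rightarrow> 'x set \<Rightarrow> ('a \<Rightarrow> 'x \<Rightarrow> 'x) \<Rightarrow> bool" where
  "finite_gset G E \<phi> \<longleftrightarrow> group_action G E \<phi> \<and> finite E"

definition gset_iso ::
    "('a, 'm) monoid_scheme \<Rightarrow> 'x set \<Rightarrow> ('a \<Rightarrow> 'x \<Rightarrow> 'x) \<Rightarrow> 'y set \<Rightarrow> ('a \<Rightarrow> 'y \<Rightarrow> 'y) \<Rightarrow> bool" where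
  "gset_iso G E \<phi> F \<psi> \<longleftrightarrow>
     (\<exists>f. bij_betw f E F \<and> (\<forall>g\<in>carrier G. \<forall>x\<in>E. f (\<phi> g x) = \<psi> g (f x)))"

type_synonym 'a gset_class = "(nat set \<times> ('a \<Rightarrow> nat \<Rightarrow> nat)) set"

text \<open>HOL has no type of all finite \<open>G\<close>-sets. The isomorphism class of a finite \<open>G\<close>-set over an
  arbitrary type is represented by the set of its isomorphic copies carried by subsets of
  \<^typ>\<open>nat\<close>; every finite \<open>G\<close>-set has such a copy.\<close>

definition gset_class ::
    "('a, 'm) monoid_scheme \<Rightarrow> 'x set \<Rightarrow> ('a \<Rightarrow> 'x \<Rightarrow> 'x) \<Rightarrow> 'a gset_class" where
  "gset_class G E \<phi> = {(D, \<psi>). finite_gset G D \<psi> \<and> gset_iso G E \<phi> D \<psi>}"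

definition sum_action ::
    "'x set \<Rightarrow> ('a \<Rightarrow> 'x \<Rightarrow> 'x) \<Rightarrow> 'y set \<Rightarrow> ('a \<Rightarrow> 'y \<Rightarrow> 'y) \<Rightarrow> 'a \<Rightarrow> 'x + 'y \<Rightarrow> 'x + 'y" where
  "sum_action D \<phi> E \<psi> = (\<lambda>g. restrict (map_sum (\<phi> g) (\<psi> g)) (D <+> E))"

definition prod_action ::
    "'x set \<Rightarrow> ('a \<Rightarrow> 'x \<Rightarrow> 'x) \<Rightarrow> 'y set \<Rightarrow> ('a \<Rightarrow> 'y \<Rightarrow> 'y) \<Rightarrow> 'a \<Rightarrow> 'x \<times> 'y \<Rightarrow> 'x \<times> 'y" where
  "prod_action D \<phi> E \<psi> = (\<lambda>g. restrict (map_prod (\<phi> g) (\<psi> g)) (D \<times> E))"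

text \<open>The commutative semiring of isomorphism classes of finite \<open>G\<close>-sets, under disjoint union and
  Cartesian product with the diagonal action. It is a \<^typ>\<open>'c ring\<close> record only as a signature;
  it has no negatives.\<close>

definition gset_semiring :: "('a, 'm) monoid_scheme \<Rightarrow> 'a gset_class ring" where
  "gset_semiring G =
     \<lparr>carrier = {gset_class G D \<phi> | (D :: nat set) \<phi>. finite_gset G D \<phi>},
      monoid.mult = (\<lambda>P Q. \<Union>(D, \<phi>)\<in>P. \<Union>(E, \<psi>)\<in>Q. gset_class G (D \<times> E) (prod_action D \<phi> E \<psi>)),
      monoid.one = gset_class G {()} (\<lambda>g. \<lambda>x\<in>{()}. x),
      ring.zero = gset_class G ({} :: unit set) (\<lambda>g. \<lambda>x\<in>{}. x),
      ring.add = (\<lambda>P Q. \<Union>(D, \<phi>)\<in>P. \<Union>(E, \<psi>)\<in>Q. gset_class G (D <+> E) (sum_action D \<phi> E \<psi>))\<rparr>"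


section \<open>The Grothendieck ring of a commutative semiring\<close>

text \<open>A pair \<open>(a, b)\<close> stands for the formal difference \<open>a - b\<close>.\<close>

definition grothendieck_rel :: "('c, 'm) ring_scheme \<Rightarrow> (('c \<times> 'c) \<times> ('c \<times> 'c)) set" where
  "grothendieck_rel S =
     {((a, b), (c, d)). a \<in> carrier S \<and> b \<in> carrier S \<and> c \<in> carrier S \<and> d \<in> carrier S \<and>
        (\<exists>e\<in>carrier S. a \<oplus>\<^bsub>S\<^esub> d \<oplus>\<^bsub>S\<^esub> e = c \<oplus>\<^bsub>S\<^esub> b \<oplus>\<^bsub>S\<^esub> e)}"

definition grothendieck_diff :: "('c, 'm) ring_scheme \<Rightarrow> 'c \<Rightarrow> 'c \<Rightarrow> ('c \<times> 'c) set" where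
  "grothendieck_diff S a b = grothendieck_rel S `` {(a, b)}"

definition grothendieck_ring :: "('c, 'm) ring_scheme \<Rightarrow> ('c \<times> 'c) set ring" where
  "grothendieck_ring S =
     \<lparr>carrier = (carrier S \<times> carrier S) // grothendieck_rel S,
      monoid.mult = (\<lambda>P Q. \<Union>(a, b)\<in>P. \<Union>(c, d)\<in>Q.
        grothendieck_diff S (a \<otimes>\<^bsub>S\<^esub> c \<oplus>\<^bsub>S\<^esub> b \<otimes>\<^bsub>S\<^esub> d) (a \<otimes>\<^bsub>S\<^esub> d \<oplus>\<^bsub>S\<^esub> b \<otimes>\<^bsub>S\<^esub> c)),
      monoid.one = grothendieck_diff S \<one>\<^bsub>S\<^esub> \<zero>\<^bsub>S\<^esub>,
      ring.zero = grothendieck_diff S \<zero>\<^bsub>S\<^esub> \<zero>\<^bsub>S\<^esub>,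
      ring.add = (\<lambda>P Q. \<Union>(a, b)\<in>P. \<Union>(c, d)\<in>Q.
        grothendieck_diff S (a \<oplus>\<^bsub>S\<^esub> c) (b \<oplus>\<^bsub>S\<^esub> d))\<rparr>"


section \<open>The Burnside ring and its basis of transitive \<open>G\<close>-sets\<close>

type_synonym 'a burnside = "('a gset_class \<times> 'a gset_class) set"

definition burnside_ring :: "('a, 'm) monoid_scheme \<Rightarrow> 'a burnside ring" where
  "burnside_ring G = grothendieck_ring (gset_semiring G)"

definition coset_action ::
    "('a, 'm) monoid_scheme \<Rightarrow> 'a set \<Rightarrow> 'a \<Rightarrow> 'a set \<Rightarrow> 'a set" where
  "coset_action G H = (\<lambda>g. \<lambda>C\<in>lcosets\<^bsub>G\<^esub> H. g <#\<^bsub>G\<^esub> C)"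

definition transitive_gset :: "('a, 'm) monoid_scheme \<Rightarrow> 'a set \<Rightarrow> 'a burnside" where
  "transitive_gset G H =
     grothendieck_diff (gset_semiring G)
       (gset_class G (lcosets\<^bsub>G\<^esub> H) (coset_action G H)) \<zero>\<^bsub>gset_semiring G\<^esub>"

definition subgroup_conj_class :: "('a, 'm) monoid_scheme \<Rightarrow> 'a set \<Rightarrow> 'a set set" where
  "subgroup_conj_class G H = {g <#\<^bsub>G\<^esub> H #>\<^bsub>G\<^esub> inv\<^bsub>G\<^esub> g | g. g \<in> carrier G}"

definition subgroup_conj_classes :: "('a, 'm) monoid_scheme \<Rightarrow> 'a set set set" where
  "subgroup_conj_classes G = {subgroup_conj_class G H | H. subgroup H G}"

text \<open>The coefficients \<open>a\<^sub>H\<close> in \<open>x = \<Sum>\<^bsub>(H)\<^esub> a\<^sub>H [G/H]\<close>, as a function of the conjugacy class \<open>(H)\<close>;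
  the choice of \<open>H\<close> in its class does not affect \<open>[G/H]\<close>.\<close>

definition burnside_coeffs ::
    "('a, 'm) monoid_scheme \<Rightarrow> 'a burnside \<Rightarrow> 'a set set \<Rightarrow> int" where
  "burnside_coeffs G x =
     (THE a. a \<in> extensional (subgroup_conj_classes G) \<and>
        x = (\<Oplus>\<^bsub>burnside_ring G\<^esub>K\<in>subgroup_conj_classes G.
               [a K] \<cdot>\<^bsub>burnside_ring G\<^esub> transitive_gset G (SOME H. H \<in> K)))"


section \<open>Normal cores\<close>

definition normal_core :: "('a, 'm) monoid_scheme \<Rightarrow> 'a set \<Rightarrow> 'a set" where
  "normal_core G H = (\<Inter>g\<in>carrier G. g <#\<^bsub>G\<^esub> H #>\<^bsub>G\<^esub> inv\<^bsub>G\<^esub> g)"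

text \<open>Conjugate subgroups have the same core, so any representative of a class may be tested.\<close>

definition core_coeff ::
    "('a, 'm) monoid_scheme \<Rightarrow> 'a set \<Rightarrow> 'a burnside \<Rightarrow> int" where
  "core_coeff G N x =
     (\<Sum>K\<in>{K \<in> subgroup_conj_classes G. \<exists>H\<in>K. normal_core G H = N}. burnside_coeffs G x K)"

definition core_coeff_sum ::
    "('a, 'm) monoid_scheme \<Rightarrow> 'a set \<Rightarrow> 'a burnside \<Rightarrow> int" where
  "core_coeff_sum G N x = (\<Sum>M\<in>{M. N \<subseteq> M \<and> M \<lhd> G}. core_coeff G M x)"

definition normal_core_compression ::
    "('a, 'm) monoid_scheme \<Rightarrow> 'a burnside \<Rightarrow> 'a burnside" where
  "normal_core_compression G =
     (THE f. f \<in> hom (add_monoid (burnside_ring G)) (add_monoid (burnside_ring G)) \<and>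
        f \<in> extensional (carrier (burnside_ring G)) \<and>
        (\<forall>H. subgroup H G \<longrightarrow> f (transitive_gset G H) = transitive_gset G (normal_core G H)))"


section \<open>Tensor products over the integers\<close>

text \<open>The additive group \<open>R \<otimes>\<^sub>\<int> S\<close> of the additive groups of two rings: the free abelian group on
  pairs modulo the biadditivity relations. As with \<^const>\<open>free_Abelian_group\<close>, the group operation
  is written as the monoid multiplication.\<close>

definition tensor_relations ::
    "('u, 'm) ring_scheme \<Rightarrow> ('v, 'n) ring_scheme \<Rightarrow> ('u \<times> 'v \<Rightarrow>\<^sub>0 int) set" where
  "tensor_relations R S =
     {frag_of (a \<oplus>\<^bsub>R\<^esub> a', b) - frag_of (a, b) - frag_of (a', b) | a a' b.
        a \<in> carrier R \<and> a' \<in> carrier R \<and> b \<in> carrier S} \<union>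
     {frag_of (a, b \<oplus>\<^bsub>S\<^esub> b') - frag_of (a, b) - frag_of (a, b') | a b b'.
        a \<in> carrier R \<and> b \<in> carrier S \<and> b' \<in> carrier S}"

definition tensor_kernel ::
    "('u, 'm) ring_scheme \<Rightarrow> ('v, 'n) ring_scheme \<Rightarrow> ('u \<times> 'v \<Rightarrow>\<^sub>0 int) set" where
  "tensor_kernel R S =
     generate (free_Abelian_group (carrier R \<times> carrier S)) (tensor_relations R S)"

definition int_tensor ::
    "('u, 'm) ring_scheme \<Rightarrow> ('v, 'n) ring_scheme \<Rightarrow> ('u \<times> 'v \<Rightarrow>\<^sub>0 int) set monoid" where
  "int_tensor R S = free_Abelian_group (carrier R \<times> carrier S) Mod tensor_kernel R S"

definition pure_tensor ::
    "('u, 'm) ring_scheme \<Rightarrow> ('v, 'n) ring_scheme \<Rightarrow> 'u \<Rightarrow> 'v \<Rightarrow> ('u \<times> 'v \<Rightarrow>\<^sub>0 int) set" where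
  "pure_tensor R S a b =
     tensor_kernel R S #>\<^bsub>free_Abelian_group (carrier R \<times> carrier S)\<^esub> frag_of (a, b)"

abbreviation burnside_tensor ::
    "('a, 'm) monoid_scheme \<Rightarrow> ('b, 'n) monoid_scheme \<Rightarrow> 'a burnside \<Rightarrow> 'b burnside \<Rightarrow>
     ('a burnside \<times> 'b burnside \<Rightarrow>\<^sub>0 int) set" where
  "burnside_tensor G1 G2 \<equiv> pure_tensor (burnside_ring G1) (burnside_ring G2)"

text \<open>The linear extension of \<open>[G\<^sub>1/H\<^sub>1] \<otimes> [G\<^sub>2/H\<^sub>2] \<mapsto> [(G\<^sub>1 \<times> G\<^sub>2)/(H\<^sub>1 \<times> H\<^sub>2)]\<close>. These pure tensors
  generate the tensor product, so additivity already determines the map; its multiplicativity is a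
  consequence and not part of the definition.\<close>

definition burnside_Prod ::
    "('a, 'm) monoid_scheme \<Rightarrow> ('b, 'n) monoid_scheme \<Rightarrow>
     ('a burnside \<times> 'b burnside \<Rightarrow>\<^sub>0 int) set \<Rightarrow> ('a \<times> 'b) burnside" where
  "burnside_Prod G1 G2 =
     (THE P. P \<in> hom (int_tensor (burnside_ring G1) (burnside_ring G2))
                      (add_monoid (burnside_ring (G1 \<times>\<times> G2))) \<and>
        P \<in> extensional (carrier (int_tensor (burnside_ring G1) (burnside_ring G2))) \<and>
        (\<forall>H1 H2. subgroup H1 G1 \<longrightarrow> subgroup H2 G2 \<longrightarrow>
           P (burnside_tensor G1 G2 (transitive_gset G1 H1) (transitive_gset G2 H2)) =
           transitive_gset (G1 \<times>\<times> G2) (H1 \<times> H2)))"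

end

theory Submission
  imports Defs
begin

text \<open>All three identities compare maps that are additive in each of \<open>x\<^sub>1\<close> and \<open>x\<^sub>2\<close>, so it suffices to
  check them on transitive sets \<open>[G\<^sub>i/H\<^sub>i]\<close>, where they reduce to
  \<open>core (H\<^sub>1 \<times> H\<^sub>2) = core H\<^sub>1 \<times> core H\<^sub>2\<close>: the coefficient \<open>c\<^sub>N\<close> of \<open>[G/H]\<close> is 1 if \<open>core H = N\<close> and 0
  otherwise, and \<open>s\<^sub>N\<close> of \<open>[G/H]\<close> is 1 if \<open>N \<subseteq> core H\<close> and 0 otherwise.

  The maps are well defined because the classes \<open>[G/H]\<close> form a basis of the Burnside ring. They
  generate it by splitting off one orbit at a time. They are independent because counting the points
  whose stabilizer lies in a conjugacy class \<open>K\<close> is additive and vanishes on \<open>[G/H]\<close> unless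
  \<open>H \<in> K\<close>.\<close>

section \<open>Isomorphism classes of finite \<open>G\<close>-sets\<close>

text \<open>The coefficients, the compression and \<open>burnside_Prod\<close> are definite
  descriptions, so nothing can be computed from them before existence and uniqueness are shown.
  Existence comes from \<open>linear_extension\<close>: it prescribes values on the [G/H], which is
  legitimate once those values depend only on the conjugacy class of H. For
  \<open>burnside_Prod\<close> it is applied once in each variable, and the resulting biadditive map
  is pushed through the universal property of the tensor product. Uniqueness is agreement of
  homomorphisms on generators.

  The count by stabilizers is preferred to the classical mark, the number of points fixed by a
  subgroup. All points of G/H have stabilizers conjugate to H, so the matrix of counts is diagonal
  with the indices of the subgroups as entries. The table of marks is only triangular and would call
  for an ordering of the conjugacy classes.\<close>

lemma group_actionI:
  assumes "group G"
    and closed: "\<And>g x. g \<in> carrier G \<Longrightarrow> x \<in> E \<Longrightarrow> \<phi> g x \<in> E"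
    and one: "\<And>x. x \<in> E \<Longrightarrow> \<phi> \<one>\<^bsub>G\<^esub> x = x"
    and mult: "\<And>g h x. g \<in> carrier G \<Longrightarrow> h \<in> carrier G \<Longrightarrow> x \<in> E \<Longrightarrow> \<phi> (g \<otimes>\<^bsub>G\<^esub> h) x = \<phi> g (\<phi> h x)"
    and ext: "\<And>g. g \<in> carrier G \<Longrightarrow> \<phi> g \<in> extensional E"
  shows "group_action G E \<phi>"
proof -
  interpret group G by fact
  have Bij: "\<phi> g \<in> Bij E" if g: "g \<in> carrier G" for g
  proof -
    \<comment> \<open>The action laws make the action of the inverse of \<open>g\<close> a two-sided
      inverse of \<open>\<phi> g\<close>.\<close>
    have "bij_betw (\<phi> g) E E"
      by (rule bij_betwI[where g = "\<phi> (inv\<^bsub>G\<^esub> g)"])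
        (use g closed one in \<open>auto simp flip: mult\<close>)
    then show ?thesis using ext[OF g] by (simp add: Bij_def)
  qed
  have "\<phi> \<in> hom G (BijGroup E)"
  proof (rule homI)
    fix g h assume gh: "g \<in> carrier G" "h \<in> carrier G"
    \<comment> \<open>The product in \<open>BijGroup E\<close> is \<open>compose E\<close>, which is
      extensional; together with \<open>ext\<close> this turns a pointwise identity on
      \<open>E\<close> into an equality of functions.\<close>
    have "\<phi> (g \<otimes>\<^bsub>G\<^esub> h) = compose E (\<phi> g) (\<phi> h)"
      by (rule extensionalityI[OF ext compose_extensional]) (use gh mult in \<open>auto simp: compose_eq\<close>)
    then show "\<phi> (g \<otimes>\<^bsub>G\<^esub> h) = \<phi> g \<otimes>\<^bsub>BijGroup E\<^esub> \<phi> h"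
      using Bij gh by (simp add: BijGroup_def)
  qed (simp add: BijGroup_def Bij)
  then show ?thesis
    by (simp add: group_action_def group_hom_def group_hom_axioms_def group_BijGroup is_group)
qed

lemma group_action_extensional:
  "group_action G E \<phi> \<Longrightarrow> g \<in> carrier G \<Longrightarrow> \<phi> g \<in> extensional E"
  using group_action.bij_prop0 by (fastforce simp: Bij_def)

lemma group_action_one:
  "group_action G E \<phi> \<Longrightarrow> x \<in> E \<Longrightarrow> \<phi> \<one>\<^bsub>G\<^esub> x = x"
  by (metis group_action.id_eq_one restrict_apply')

lemma group_action_closed:
  "group_action G E \<phi> \<Longrightarrow> g \<in> carrier G \<Longrightarrow> x \<in> E \<Longrightarrow> \<phi> g x \<in> E"
  using group_action.element_image by fastforce

lemmas group_action_rules =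
  group_action_closed group_action_one group_action.composition_rule group_action_extensional

text \<open>An explicit inverse replaces injectivity and surjectivity, so the concrete isomorphisms
  below reduce to case analysis and simplification.\<close>

lemma gset_isoI:
  assumes "\<And>x. x \<in> E \<Longrightarrow> f x \<in> F" "\<And>y. y \<in> F \<Longrightarrow> f' y \<in> E"
    and "\<And>x. x \<in> E \<Longrightarrow> f' (f x) = x" "\<And>y. y \<in> F \<Longrightarrow> f (f' y) = y"
    and "\<And>g x. g \<in> carrier G \<Longrightarrow> x \<in> E \<Longrightarrow> f (\<phi> g x) = \<psi> g (f x)"
  shows "gset_iso G E \<phi> F \<psi>"
  unfolding gset_iso_def using assms by (intro exI[of _ f] conjI bij_betwI[where g = f']) auto

lemma gset_isoE:
  assumes "gset_iso G E \<phi> F \<psi>"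
  obtains f f' where "\<And>x. x \<in> E \<Longrightarrow> f x \<in> F" "\<And>y. y \<in> F \<Longrightarrow> f' y \<in> E"
    "\<And>x. x \<in> E \<Longrightarrow> f' (f x) = x" "\<And>y. y \<in> F \<Longrightarrow> f (f' y) = y"
    "\<And>g x. g \<in> carrier G \<Longrightarrow> x \<in> E \<Longrightarrow> f (\<phi> g x) = \<psi> g (f x)"
proof -
  obtain f where f: "bij_betw f E F" "\<And>g x. g \<in> carrier G \<Longrightarrow> x \<in> E \<Longrightarrow> f (\<phi> g x) = \<psi> g (f x)"
    using assms unfolding gset_iso_def by blast
  show ?thesis
  proof (rule that[of f "inv_into E f"])
    show "inv_into E f y \<in> E" "f (inv_into E f y) = y" if "y \<in> F" for y
      using f(1) that by (auto simp: bij_betw_def inv_into_into f_inv_into_f)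
  qed (use f in \<open>auto simp: bij_betw_def inv_into_into\<close>)
qed

text \<open>Equivariance passes to the inverse because \<open>\<phi> g (f' y)\<close> stays in
  \<open>E\<close>, where \<open>f'\<close> cancels \<open>f\<close>; this is what the action on
  \<open>E\<close> is for.\<close>

lemma gset_iso_sym:
  assumes "group_action G E \<phi>" "gset_iso G E \<phi> F \<psi>"
  shows "gset_iso G F \<psi> E \<phi>"
proof -
  obtain f f' where f: "\<And>x. x \<in> E \<Longrightarrow> f x \<in> F" "\<And>y. y \<in> F \<Longrightarrow> f' y \<in> E"
    "\<And>x. x \<in> E \<Longrightarrow> f' (f x) = x" "\<And>y. y \<in> F \<Longrightarrow> f (f' y) = y"
    "\<And>g x. g \<in> carrier G \<Longrightarrow> x \<in> E \<Longrightarrow> f (\<phi> g x) = \<psi> g (f x)"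
    using assms(2) by (rule gset_isoE) blast
  show ?thesis
  proof (rule gset_isoI[where f = f' and f' = f])
    fix g y assume "g \<in> carrier G" "y \<in> F"
    then show "f' (\<psi> g y) = \<phi> g (f' y)"
      using f group_action_closed[OF assms(1)] by metis
  qed (use f in auto)
qed

lemma gset_iso_trans:
  assumes "gset_iso G E \<phi> F \<psi>" "gset_iso G F \<psi> D \<chi>"
  shows "gset_iso G E \<phi> D \<chi>"
proof -
  obtain f where f: "bij_betw f E F" "\<forall>g\<in>carrier G. \<forall>x\<in>E. f (\<phi> g x) = \<psi> g (f x)"
    using assms(1) by (auto simp: gset_iso_def)
  obtain h where h: "bij_betw h F D" "\<forall>g\<in>carrier G. \<forall>x\<in>F. h (\<psi> g x) = \<chi> g (h x)"
    using assms(2) by (auto simp: gset_iso_def)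
  have "\<forall>g\<in>carrier G. \<forall>x\<in>E. (h \<circ> f) (\<phi> g x) = \<chi> g ((h \<circ> f) x)"
    using f h by (auto simp: bij_betw_def)
  then show ?thesis unfolding gset_iso_def using bij_betw_trans[OF f(1) h(1)] by blast
qed

lemma gset_class_eq:
  assumes "group_action G E \<phi>" "gset_iso G E \<phi> F \<psi>"
  shows "gset_class G E \<phi> = gset_class G F \<psi>"
  unfolding gset_class_def
  using gset_iso_trans[OF assms(2)] gset_iso_trans[OF gset_iso_sym[OF assms]] by blast

lemma finite_gset_action: "finite_gset G E \<phi> \<Longrightarrow> group_action G E \<phi>"
  by (simp add: finite_gset_def)

text \<open>Transport of structure along an enumeration of \<open>E\<close> by an initial segment of
  the naturals. It shows that \<open>gset_class\<close> of a finite G-set over any type is inhabited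
  and lies in the carrier of the semiring.\<close>

lemma gset_class_exhaust:
  assumes "finite_gset G E \<phi>"
  obtains D :: "nat set" and \<psi> where "finite_gset G D \<psi>" "gset_iso G E \<phi> D \<psi>"
    "gset_class G E \<phi> = gset_class G D \<psi>"
proof -
  have act: "group_action G E \<phi>" and fin: "finite E" using assms by (auto simp: finite_gset_def)
  note rules = group_action_rules[OF act]
  obtain f where f: "bij_betw f E {0..<card E}" using ex_bij_betw_finite_nat[OF fin] by blast
  define D where "D = {0..<card E}"
  define f' where "f' = inv_into E f"
  have f': "\<And>x. x \<in> E \<Longrightarrow> f x \<in> D" "\<And>y. y \<in> D \<Longrightarrow> f' y \<in> E"
    "\<And>x. x \<in> E \<Longrightarrow> f' (f x) = x" "\<And>y. y \<in> D \<Longrightarrow> f (f' y) = y"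
    using f by (auto simp: bij_betw_def D_def f'_def inv_into_into f_inv_into_f)
  define \<psi> where "\<psi> = (\<lambda>g. \<lambda>y\<in>D. f (\<phi> g (f' y)))"
  have "group G" using act group_action.group_hom group_hom.axioms(1) by blast
  have "group_action G D \<psi>"
    by (rule group_actionI[OF \<open>group G\<close>]) (auto simp: \<psi>_def f' rules)
  then have "finite_gset G D \<psi>" by (simp add: finite_gset_def D_def)
  moreover have "gset_iso G E \<phi> D \<psi>"
    by (rule gset_isoI[where f = f and f' = f']) (auto simp: \<psi>_def f' rules)
  ultimately show ?thesis using that gset_class_eq[OF act] by blast
qed

lemma gset_class_closed:
  "finite_gset G E \<phi> \<Longrightarrow> gset_class G E \<phi> \<in> carrier (gset_semiring G)"
  by (erule gset_class_exhaust) (auto simp: gset_semiring_def)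

lemma gset_semiring_cases:
  assumes "P \<in> carrier (gset_semiring G)"
  obtains D :: "nat set" and \<phi> where "finite_gset G D \<phi>" "P = gset_class G D \<phi>"
  using assms by (auto simp: gset_semiring_def)

section \<open>Disjoint unions and the additive monoid of isomorphism classes\<close>

lemma sum_action_simps [simp]:
  "x \<in> D \<Longrightarrow> sum_action D \<phi> E \<psi> g (Inl x) = Inl (\<phi> g x)"
  "y \<in> E \<Longrightarrow> sum_action D \<phi> E \<psi> g (Inr y) = Inr (\<psi> g y)"
  by (auto simp: sum_action_def)

lemma finite_gset_sum:
  assumes "finite_gset G D \<phi>" "finite_gset G E \<psi>"
  shows "finite_gset G (D <+> E) (sum_action D \<phi> E \<psi>)"
proof -
  have act: "group_action G D \<phi>" "group_action G E \<psi>" using assms by (auto simp: finite_gset_def)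
  then have "group G" using group_action.group_hom group_hom.axioms(1) by blast
  have "group_action G (D <+> E) (sum_action D \<phi> E \<psi>)"
    by (rule group_actionI[OF \<open>group G\<close>])
      (auto simp: group_action_rules[OF act(1)] group_action_rules[OF act(2)], simp add: sum_action_def)
  then show ?thesis using assms by (simp add: finite_gset_def)
qed

lemma gset_iso_sum:
  assumes "group_action G D \<phi>" "group_action G E \<psi>" "gset_iso G D \<phi> D' \<phi>'" "gset_iso G E \<psi> E' \<psi>'"
  shows "gset_iso G (D <+> E) (sum_action D \<phi> E \<psi>) (D' <+> E') (sum_action D' \<phi>' E' \<psi>')"
proof -
  obtain f f' where f: "\<And>x. x \<in> D \<Longrightarrow> f x \<in> D'" "\<And>y. y \<in> D' \<Longrightarrow> f' y \<in> D"
    "\<And>x. x \<in> D \<Longrightarrow> f' (f x) = x" "\<And>y. y \<in> D' \<Longrightarrow> f (f' y) = y"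
    "\<And>g x. g \<in> carrier G \<Longrightarrow> x \<in> D \<Longrightarrow> f (\<phi> g x) = \<phi>' g (f x)"
    using assms(3) by (rule gset_isoE) blast
  obtain h h' where h: "\<And>x. x \<in> E \<Longrightarrow> h x \<in> E'" "\<And>y. y \<in> E' \<Longrightarrow> h' y \<in> E"
    "\<And>x. x \<in> E \<Longrightarrow> h' (h x) = x" "\<And>y. y \<in> E' \<Longrightarrow> h (h' y) = y"
    "\<And>g x. g \<in> carrier G \<Longrightarrow> x \<in> E \<Longrightarrow> h (\<psi> g x) = \<psi>' g (h x)"
    using assms(4) by (rule gset_isoE) blast
  show ?thesis
    by (rule gset_isoI[where f = "map_sum f h" and f' = "map_sum f' h'"]) (auto simp: f h)
qed

text \<open>The sum is defined as a union over all models of both classes. All members of that union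
  coincide, since isomorphic summands have isomorphic sums, and the union is not empty because both
  classes have a model on the naturals.\<close>

lemma gset_class_add:
  assumes "finite_gset G D \<phi>" "finite_gset G E \<psi>"
  shows "gset_class G D \<phi> \<oplus>\<^bsub>gset_semiring G\<^esub> gset_class G E \<psi> =
    gset_class G (D <+> E) (sum_action D \<phi> E \<psi>)" (is "_ = ?S")
proof -
  have act: "group_action G D \<phi>" "group_action G E \<psi>" using assms by (auto simp: finite_gset_def)
  have const: "gset_class G (D' <+> E') (sum_action D' \<phi>' E' \<psi>') = ?S"
    if "(D', \<phi>') \<in> gset_class G D \<phi>" "(E', \<psi>') \<in> gset_class G E \<psi>" for D' \<phi>' E' \<psi>'
    using that gset_iso_sum[OF act] finite_gset_sum[OF assms]
    by (auto simp: gset_class_def[of G D] gset_class_def[of G E] finite_gset_def intro!: gset_class_eq[symmetric])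
  have "gset_class G D \<phi> \<noteq> {}" "gset_class G E \<psi> \<noteq> {}"
    using gset_class_exhaust[OF assms(1)] gset_class_exhaust[OF assms(2)]
    by (fastforce simp: gset_class_def)+
  then obtain D' \<phi>' E' \<psi>' where "(D', \<phi>') \<in> gset_class G D \<phi>" "(E', \<psi>') \<in> gset_class G E \<psi>" by fast
  with const show ?thesis
    unfolding gset_semiring_def by (auto simp: split_beta)
qed

lemma gset_semiring_zero:
  "\<zero>\<^bsub>gset_semiring G\<^esub> = gset_class G ({} :: unit set) (\<lambda>g. \<lambda>x\<in>{}. x)"
  by (simp add: gset_semiring_def)

lemma finite_gset_empty:
  assumes "group G"
  shows "finite_gset G {} (\<lambda>g. \<lambda>x\<in>{}. x)"
  unfolding finite_gset_def by (auto intro: group_actionI[OF assms])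

lemma abelian_monoid_gset_semiring:
  assumes "group G"
  shows "abelian_monoid (gset_semiring G)"
proof (rule abelian_monoidI)
  show "\<zero>\<^bsub>gset_semiring G\<^esub> \<in> carrier (gset_semiring G)"
    unfolding gset_semiring_zero by (rule gset_class_closed[OF finite_gset_empty[OF assms]])
next
  fix x y assume "x \<in> carrier (gset_semiring G)" "y \<in> carrier (gset_semiring G)"
  then show "x \<oplus>\<^bsub>gset_semiring G\<^esub> y \<in> carrier (gset_semiring G)"
    by (elim gset_semiring_cases) (simp add: gset_class_add finite_gset_sum gset_class_closed)
next
  fix x y z assume "x \<in> carrier (gset_semiring G)" "y \<in> carrier (gset_semiring G)"
    "z \<in> carrier (gset_semiring G)"
  then obtain D E F :: "nat set" and \<phi> \<psi> \<chi> where fin: "finite_gset G D \<phi>" "finite_gset G E \<psi>" "finite_gset G F \<chi>"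
    and xyz: "x = gset_class G D \<phi>" "y = gset_class G E \<psi>" "z = gset_class G F \<chi>"
    by (elim gset_semiring_cases) blast
  define f :: "(nat + nat) + nat \<Rightarrow> nat + (nat + nat)"
    where "f = case_sum (case_sum Inl (Inr \<circ> Inl)) (Inr \<circ> Inr)"
  define f' :: "nat + (nat + nat) \<Rightarrow> (nat + nat) + nat"
    where "f' = case_sum (Inl \<circ> Inl) (case_sum (Inl \<circ> Inr) Inr)"
  have "gset_iso G ((D <+> E) <+> F) (sum_action (D <+> E) (sum_action D \<phi> E \<psi>) F \<chi>)
      (D <+> (E <+> F)) (sum_action D \<phi> (E <+> F) (sum_action E \<psi> F \<chi>))"
    by (rule gset_isoI[where f = f and f' = f']) (auto simp: f_def f'_def InlI InrI)
  then show "(x \<oplus>\<^bsub>gset_semiring G\<^esub> y) \<oplus>\<^bsub>gset_semiring G\<^esub> z = x \<oplus>\<^bsub>gset_semiring G\<^esub> (y \<oplus>\<^bsub>gset_semiring G\<^esub> z)"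
    unfolding xyz using fin finite_gset_sum[OF finite_gset_sum[OF fin(1,2)] fin(3)]
    by (simp add: gset_class_add finite_gset_sum gset_class_eq[OF finite_gset_action])
next
  fix x assume "x \<in> carrier (gset_semiring G)"
  then obtain D :: "nat set" and \<phi> where fin: "finite_gset G D \<phi>" and x: "x = gset_class G D \<phi>"
    by (elim gset_semiring_cases) blast
  let ?e = "\<lambda>g :: 'a. \<lambda>x\<in>{} :: unit set. x"
  \<comment> \<open>The value \<open>undefined\<close> is harmless: the left summand has no
    points.\<close>
  have "gset_iso G ({} <+> D) (sum_action {} ?e D \<phi>) D \<phi>"
    by (rule gset_isoI[where f = "case_sum (\<lambda>_. undefined) id" and f' = Inr]) auto
  then show "\<zero>\<^bsub>gset_semiring G\<^esub> \<oplus>\<^bsub>gset_semiring G\<^esub> x = x"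
    unfolding x gset_semiring_zero gset_class_add[OF finite_gset_empty[OF assms] fin]
    by (rule gset_class_eq[OF finite_gset_action[OF finite_gset_sum[OF finite_gset_empty[OF assms] fin]]])
next
  fix x y assume "x \<in> carrier (gset_semiring G)" "y \<in> carrier (gset_semiring G)"
  then obtain D E :: "nat set" and \<phi> \<psi> where fin: "finite_gset G D \<phi>" "finite_gset G E \<psi>"
    and xy: "x = gset_class G D \<phi>" "y = gset_class G E \<psi>"
    by (elim gset_semiring_cases) blast
  have "gset_iso G (D <+> E) (sum_action D \<phi> E \<psi>) (E <+> D) (sum_action E \<psi> D \<phi>)"
    by (rule gset_isoI[where f = "case_sum Inr Inl" and f' = "case_sum Inr Inl"]) auto
  then show "x \<oplus>\<^bsub>gset_semiring G\<^esub> y = y \<oplus>\<^bsub>gset_semiring G\<^esub> x"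
    unfolding xy using fin finite_gset_sum[OF fin]
    by (simp add: gset_class_add gset_class_eq[OF finite_gset_action])
qed

section \<open>The Grothendieck group of a commutative monoid\<close>

text \<open>For operations on quotients that are defined as unions over representatives. The two
  given pairs ensure that neither union is empty.\<close>

lemma UN_UN_case_prod_const:
  assumes "(a, b) \<in> P" "(c, d) \<in> Q"
    and "\<And>a b c d. (a, b) \<in> P \<Longrightarrow> (c, d) \<in> Q \<Longrightarrow> F a b c d = S"
  shows "(\<Union>(a, b)\<in>P. \<Union>(c, d)\<in>Q. F a b c d) = S"
proof (rule SUP_eq_const)
  fix p assume "p \<in> P"
  have "(\<Union>(c, d)\<in>Q. F (fst p) (snd p) c d) = S"
  proof (rule SUP_eq_const)
    fix q assume "q \<in> Q"
    then show "(case q of (c, d) \<Rightarrow> F (fst p) (snd p) c d) = S"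
      using assms(3)[of "fst p" "snd p" "fst q" "snd q"] \<open>p \<in> P\<close> by (simp add: split_beta)
  qed (use assms(2) in blast)
  then show "(case p of (a, b) \<Rightarrow> \<Union>(c, d)\<in>Q. F a b c d) = S" by (simp add: split_beta)
qed (use assms(1) in blast)

context abelian_monoid
begin

lemma grothendieck_equiv: "equiv (carrier G \<times> carrier G) (grothendieck_rel G)"
proof (rule equivI)
  show "trans (grothendieck_rel G)"
  proof (rule transI, clarify)
    fix a b c d e f
    assume "((a, b), (c, d)) \<in> grothendieck_rel G" "((c, d), (e, f)) \<in> grothendieck_rel G"
    then obtain u v where car: "a \<in> carrier G" "b \<in> carrier G" "c \<in> carrier G" "d \<in> carrier G"
      "e \<in> carrier G" "f \<in> carrier G" "u \<in> carrier G" "v \<in> carrier G"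
      and eqs: "a \<oplus> d \<oplus> u = c \<oplus> b \<oplus> u" "c \<oplus> f \<oplus> v = e \<oplus> d \<oplus> v"
      unfolding grothendieck_rel_def by auto
    \<comment> \<open>Without cancellation the middle term \<open>d\<close> cannot be removed, so it
      joins the two witnesses: with \<open>d\<close> and \<open>u\<close> present the first equation
      applies, and the \<open>d\<close> it consumes comes back when the second is applied.\<close>
    let ?w = "d \<oplus> u \<oplus> v"
    have "a \<oplus> f \<oplus> ?w = (a \<oplus> d \<oplus> u) \<oplus> (f \<oplus> v)" using car by (simp add: a_ac)
    also have "\<dots> = (c \<oplus> f \<oplus> v) \<oplus> (b \<oplus> u)" unfolding eqs(1) using car by (simp add: a_ac)
    also have "\<dots> = e \<oplus> b \<oplus> ?w" unfolding eqs(2) using car by (simp add: a_ac)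
    finally have "a \<oplus> f \<oplus> ?w = e \<oplus> b \<oplus> ?w" .
    moreover have "?w \<in> carrier G" using car by simp
    ultimately show "((a, b), (e, f)) \<in> grothendieck_rel G"
      using car unfolding grothendieck_rel_def by blast
  qed
  show "sym (grothendieck_rel G)" unfolding sym_def grothendieck_rel_def by force
  show "refl_on (carrier G \<times> carrier G) (grothendieck_rel G)"
    unfolding refl_on_def grothendieck_rel_def by auto
  show "grothendieck_rel G \<subseteq> (carrier G \<times> carrier G) \<times> carrier G \<times> carrier G"
    unfolding grothendieck_rel_def by auto
qed

lemma grothendieck_diff_eq_iff:
  assumes "a \<in> carrier G" "b \<in> carrier G" "c \<in> carrier G" "d \<in> carrier G"
  shows "grothendieck_diff G a b = grothendieck_diff G c d \<longleftrightarrow>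
    (\<exists>e\<in>carrier G. a \<oplus> d \<oplus> e = c \<oplus> b \<oplus> e)"
proof -
  have "grothendieck_diff G a b = grothendieck_diff G c d \<longleftrightarrow> ((a, b), (c, d)) \<in> grothendieck_rel G"
    unfolding grothendieck_diff_def by (rule eq_equiv_class_iff[OF grothendieck_equiv]) (use assms in auto)
  also have "\<dots> \<longleftrightarrow> (\<exists>e\<in>carrier G. a \<oplus> d \<oplus> e = c \<oplus> b \<oplus> e)"
    using assms by (simp add: grothendieck_rel_def)
  finally show ?thesis .
qed

lemma carrier_grothendieck_ring:
  "carrier (grothendieck_ring G) = (carrier G \<times> carrier G) // grothendieck_rel G"
  by (simp add: grothendieck_ring_def)

lemma grothendieck_diff_closed:
  assumes "a \<in> carrier G" "b \<in> carrier G"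
  shows "grothendieck_diff G a b \<in> carrier (grothendieck_ring G)"
  unfolding carrier_grothendieck_ring grothendieck_diff_def using assms by (intro quotientI) simp

lemma grothendieck_ring_cases:
  assumes "x \<in> carrier (grothendieck_ring G)"
  obtains a b where "a \<in> carrier G" "b \<in> carrier G" "x = grothendieck_diff G a b"
proof -
  obtain p where "p \<in> carrier G \<times> carrier G" "x = grothendieck_rel G `` {p}"
    using assms unfolding carrier_grothendieck_ring by (rule quotientE)
  then show ?thesis using that[of "fst p" "snd p"] by (auto simp: grothendieck_diff_def)
qed

text \<open>If \<open>u\<close> and \<open>v\<close> witness the equivalence of two choices of
  representatives, then \<open>u \<oplus> v\<close> witnesses that of the sums. The union in the
  definition is therefore constant, and it is inhabited because each class contains its own
  pair.\<close>

lemma grothendieck_diff_add: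
  assumes ab: "a \<in> carrier G" "b \<in> carrier G" and cd: "c \<in> carrier G" "d \<in> carrier G"
  shows "grothendieck_diff G a b \<oplus>\<^bsub>grothendieck_ring G\<^esub> grothendieck_diff G c d =
    grothendieck_diff G (a \<oplus> c) (b \<oplus> d)"
proof -
  have const: "grothendieck_diff G (a' \<oplus> c') (b' \<oplus> d') = grothendieck_diff G (a \<oplus> c) (b \<oplus> d)"
    if "(a', b') \<in> grothendieck_diff G a b" "(c', d') \<in> grothendieck_diff G c d" for a' b' c' d'
  proof -
    have "((a, b), (a', b')) \<in> grothendieck_rel G" "((c, d), (c', d')) \<in> grothendieck_rel G"
      using that by (auto simp: grothendieck_diff_def)
    then obtain u v where car: "a' \<in> carrier G" "b' \<in> carrier G" "c' \<in> carrier G" "d' \<in> carrier G"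
      "u \<in> carrier G" "v \<in> carrier G"
      and eqs: "a \<oplus> b' \<oplus> u = a' \<oplus> b \<oplus> u" "c \<oplus> d' \<oplus> v = c' \<oplus> d \<oplus> v"
      by (simp add: grothendieck_rel_def) blast
    have "a' \<oplus> c' \<oplus> (b \<oplus> d) \<oplus> (u \<oplus> v) = (a' \<oplus> b \<oplus> u) \<oplus> (c' \<oplus> d \<oplus> v)"
      using car ab cd by (simp add: a_ac)
    also have "\<dots> = a \<oplus> c \<oplus> (b' \<oplus> d') \<oplus> (u \<oplus> v)"
      unfolding eqs[symmetric] using car ab cd by (simp add: a_ac)
    finally have "a' \<oplus> c' \<oplus> (b \<oplus> d) \<oplus> (u \<oplus> v) = a \<oplus> c \<oplus> (b' \<oplus> d') \<oplus> (u \<oplus> v)" .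
    moreover have "u \<oplus> v \<in> carrier G" using car by simp
    ultimately show ?thesis
      using car ab cd grothendieck_diff_eq_iff[of "a' \<oplus> c'" "b' \<oplus> d'" "a \<oplus> c" "b \<oplus> d"] by auto
  qed
  have "(a, b) \<in> grothendieck_diff G a b" "(c, d) \<in> grothendieck_diff G c d"
    using ab cd unfolding grothendieck_diff_def grothendieck_rel_def by auto
  then show ?thesis
    unfolding grothendieck_ring_def by (simp add: UN_UN_case_prod_const[OF _ _ const])
qed

lemma grothendieck_zero: "\<zero>\<^bsub>grothendieck_ring G\<^esub> = grothendieck_diff G \<zero> \<zero>"
  by (simp add: grothendieck_ring_def)

lemma abelian_group_grothendieck: "abelian_group (grothendieck_ring G)"
proof (rule abelian_groupI)
  fix x assume "x \<in> carrier (grothendieck_ring G)"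
  then obtain a b where ab: "a \<in> carrier G" "b \<in> carrier G" "x = grothendieck_diff G a b"
    by (rule grothendieck_ring_cases)
  have "grothendieck_diff G b a \<oplus>\<^bsub>grothendieck_ring G\<^esub> x = \<zero>\<^bsub>grothendieck_ring G\<^esub>"
    unfolding ab(3) grothendieck_zero using ab
    by (simp add: grothendieck_diff_add grothendieck_diff_eq_iff)
      (auto simp: a_comm)
  then show "\<exists>y\<in>carrier (grothendieck_ring G). y \<oplus>\<^bsub>grothendieck_ring G\<^esub> x = \<zero>\<^bsub>grothendieck_ring G\<^esub>"
    using grothendieck_diff_closed ab by blast
next
  fix x y z assume "x \<in> carrier (grothendieck_ring G)" "y \<in> carrier (grothendieck_ring G)"
    "z \<in> carrier (grothendieck_ring G)"
  then show "x \<oplus>\<^bsub>grothendieck_ring G\<^esub> y \<oplus>\<^bsub>grothendieck_ring G\<^esub> z =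
    x \<oplus>\<^bsub>grothendieck_ring G\<^esub> (y \<oplus>\<^bsub>grothendieck_ring G\<^esub> z)"
    by (elim grothendieck_ring_cases) (simp add: grothendieck_diff_add a_assoc)
next
  fix x y assume "x \<in> carrier (grothendieck_ring G)" "y \<in> carrier (grothendieck_ring G)"
  then show "x \<oplus>\<^bsub>grothendieck_ring G\<^esub> y = y \<oplus>\<^bsub>grothendieck_ring G\<^esub> x"
    by (elim grothendieck_ring_cases) (simp add: grothendieck_diff_add a_comm)
next
  fix x y assume "x \<in> carrier (grothendieck_ring G)" "y \<in> carrier (grothendieck_ring G)"
  then show "x \<oplus>\<^bsub>grothendieck_ring G\<^esub> y \<in> carrier (grothendieck_ring G)"
    by (elim grothendieck_ring_cases) (simp add: grothendieck_diff_add grothendieck_diff_closed)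
next
  fix x assume "x \<in> carrier (grothendieck_ring G)"
  then show "\<zero>\<^bsub>grothendieck_ring G\<^esub> \<oplus>\<^bsub>grothendieck_ring G\<^esub> x = x"
    by (elim grothendieck_ring_cases) (simp add: grothendieck_zero grothendieck_diff_add)
qed (simp add: grothendieck_zero grothendieck_diff_closed)

lemma grothendieck_diff_neg:
  assumes "a \<in> carrier G" "b \<in> carrier G"
  shows "\<ominus>\<^bsub>grothendieck_ring G\<^esub> grothendieck_diff G a b = grothendieck_diff G b a"
proof -
  interpret R: abelian_group "grothendieck_ring G" by (rule abelian_group_grothendieck)
  have "grothendieck_diff G b a \<oplus>\<^bsub>grothendieck_ring G\<^esub> grothendieck_diff G a b = \<zero>\<^bsub>grothendieck_ring G\<^esub>"
    unfolding grothendieck_zero using assms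
    by (simp add: grothendieck_diff_add grothendieck_diff_eq_iff) (auto simp: a_comm)
  then show ?thesis using assms by (simp add: R.minus_equality grothendieck_diff_closed)
qed

text \<open>Cancellation in the target removes the auxiliary summand \<open>e\<close>, so
  \<open>h a - h b\<close> depends only on the formal difference. This extends counts of points from
  G-sets to virtual G-sets.\<close>

lemma grothendieck_extend_additive:
  fixes h :: "'a \<Rightarrow> 'z::ab_group_add"
  assumes add: "\<And>a b. a \<in> carrier G \<Longrightarrow> b \<in> carrier G \<Longrightarrow> h (a \<oplus> b) = h a + h b"
  obtains k where
    "\<And>a b. a \<in> carrier G \<Longrightarrow> b \<in> carrier G \<Longrightarrow> k (grothendieck_diff G a b) = h a - h b"
    "\<And>x y. x \<in> carrier (grothendieck_ring G) \<Longrightarrow> y \<in> carrier (grothendieck_ring G) \<Longrightarrow>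
       k (x \<oplus>\<^bsub>grothendieck_ring G\<^esub> y) = k x + k y"
proof
  define k where "k x = (THE v. \<exists>a\<in>carrier G. \<exists>b\<in>carrier G. x = grothendieck_diff G a b \<and> v = h a - h b)" for x
  show k: "k (grothendieck_diff G a b) = h a - h b" if ab: "a \<in> carrier G" "b \<in> carrier G" for a b
    unfolding k_def
  proof (rule the_equality)
    fix v assume "\<exists>c\<in>carrier G. \<exists>d\<in>carrier G. grothendieck_diff G a b = grothendieck_diff G c d \<and> v = h c - h d"
    then obtain c d where cd: "c \<in> carrier G" "d \<in> carrier G" "v = h c - h d"
      "grothendieck_diff G a b = grothendieck_diff G c d" by blast
    then obtain e where "e \<in> carrier G" "a \<oplus> d \<oplus> e = c \<oplus> b \<oplus> e"
      using ab by (auto simp: grothendieck_diff_eq_iff)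
    then have "h a + h d + h e = h c + h b + h e"
      using ab cd by (metis add a_closed)
    then show "v = h a - h b" by (simp add: cd algebra_simps)
  qed (use ab in blast)
  show "k (x \<oplus>\<^bsub>grothendieck_ring G\<^esub> y) = k x + k y"
    if "x \<in> carrier (grothendieck_ring G)" "y \<in> carrier (grothendieck_ring G)" for x y
    using that by (elim grothendieck_ring_cases) (simp add: grothendieck_diff_add k add)
qed

end

section \<open>Cosets, conjugates and the orbit decomposition\<close>

text \<open>Opens the orbit theory of \<open>group_action\<close> to conjugacy classes of subgroups,
  in particular their symmetry and transitivity.\<close>

lemma orbit_conjugation_eq:
  assumes "subgroup H G"
  shows "orbit G (\<lambda>g. \<lambda>H\<in>{H. subgroup H G}. g <#\<^bsub>G\<^esub> H #>\<^bsub>G\<^esub> inv\<^bsub>G\<^esub> g) H = subgroup_conj_class G H"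
  using assms by (simp add: orbit_def subgroup_conj_class_def)

context group
begin

lemma subgroup_conj_class_self:
  assumes "subgroup H G"
  shows "H \<in> subgroup_conj_class G H"
  using group_action.orbit_refl[OF action_by_conjugation_on_subgroups_set, of H] assms
  by (simp add: orbit_conjugation_eq)

lemma subgroup_conj_class_subgroup:
  assumes "subgroup H G" "H' \<in> subgroup_conj_class G H"
  shows "subgroup H' G"
  using assms subgroup_conjugation_is_surj2 by (auto simp: subgroup_conj_class_def)

lemma subgroup_conj_class_eq:
  assumes "subgroup H G" "H' \<in> subgroup_conj_class G H"
  shows "subgroup_conj_class G H' = subgroup_conj_class G H"
proof -
  interpret conj: group_action G "{H. subgroup H G}" "\<lambda>g. \<lambda>H\<in>{H. subgroup H G}. g <# H #> inv g"
    by (rule action_by_conjugation_on_subgroups_set)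
  let ?O = "orbit G (\<lambda>g. \<lambda>H\<in>{H. subgroup H G}. g <# H #> inv g)"
  have sub: "subgroup H' G" by (rule subgroup_conj_class_subgroup[OF assms])
  have "H' \<in> ?O H" using assms by (simp add: orbit_conjugation_eq)
  moreover have "H \<in> ?O H'" using conj.orbit_sym calculation assms sub by blast
  moreover have "?O H \<subseteq> {H. subgroup H G}" "?O H' \<subseteq> {H. subgroup H G}"
    using sub assms subgroup_conj_class_subgroup orbit_conjugation_eq by blast+
  ultimately have "?O H' = ?O H"
    using conj.orbit_trans[of H' H] conj.orbit_trans[of H H'] sub assms by blast
  then show ?thesis using sub assms by (simp add: orbit_conjugation_eq)
qed

lemma subgroup_conj_classes_mem:
  assumes "K \<in> subgroup_conj_classes G" "H \<in> K"
  shows "subgroup H G" "subgroup_conj_class G H = K"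
proof -
  obtain H0 where H0: "subgroup H0 G" "K = subgroup_conj_class G H0"
    using assms(1) by (auto simp: subgroup_conj_classes_def)
  then show "subgroup H G" "subgroup_conj_class G H = K"
    using subgroup_conj_class_subgroup[of H0 H] subgroup_conj_class_eq[of H0 H] assms(2) by simp_all
qed

lemma subgroup_conj_classes_mem_iff:
  assumes "K \<in> subgroup_conj_classes G" "subgroup H G"
  shows "H \<in> K \<longleftrightarrow> K = subgroup_conj_class G H"
  using assms subgroup_conj_classes_mem(2) subgroup_conj_class_self by blast

text \<open>Justifies the choice of representatives made in \<open>burnside_coeffs\<close>.\<close>

lemma subgroup_conj_classes_some:
  assumes "K \<in> subgroup_conj_classes G"
  shows "(SOME H. H \<in> K) \<in> K"
proof -
  obtain H0 where "subgroup H0 G" "K = subgroup_conj_class G H0"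
    using assms by (auto simp: subgroup_conj_classes_def)
  then show ?thesis using someI[of "\<lambda>H. H \<in> K" H0] subgroup_conj_class_self by simp
qed

lemma finite_subgroup_conj_classes:
  assumes "finite (carrier G)"
  shows "finite (subgroup_conj_classes G)"
proof (rule finite_subset)
  show "subgroup_conj_classes G \<subseteq> Pow (Pow (carrier G))"
    using subgroup_conj_classes_mem(1) subgroup.subset by blast
qed (simp add: assms)

lemma coset_action_apply:
  assumes "subgroup H G" "g \<in> carrier G" "a \<in> carrier G"
  shows "coset_action G H g (a <# H) = (g \<otimes> a) <# H"
  using assms lcos_m_assoc[OF subgroup.subset[OF assms(1)]]
  by (auto simp: coset_action_def LCOSETS_def)

lemma finite_gset_coset:
  assumes "finite (carrier G)" "subgroup H G"
  shows "finite_gset G (lcosets H) (coset_action G H)"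
proof -
  have "group_action G (lcosets H) (coset_action G H)"
  proof (rule group_actionI[OF is_group])
    show "coset_action G H g \<in> extensional (lcosets H)" for g
      by (simp add: coset_action_def)
  qed (auto simp: LCOSETS_def coset_action_apply assms m_assoc)
  moreover have "lcosets H = (\<lambda>a. a <# H) ` carrier G" by (auto simp: LCOSETS_def)
  ultimately show ?thesis using assms(1) by (simp add: finite_gset_def)
qed

lemma l_coset_eq_iff:
  assumes "subgroup H G" "a \<in> carrier G" "b \<in> carrier G"
  shows "a <# H = b <# H \<longleftrightarrow> inv a \<otimes> b \<in> H"
proof
  show "inv a \<otimes> b \<in> H" if "a <# H = b <# H"
    using subgroup.lcos_module_imp[OF assms(1) is_group assms(2)] lcos_self[OF assms(3,1)] that by simp
  show "a <# H = b <# H" if "inv a \<otimes> b \<in> H"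
    using subgroup.lcos_module_rev[OF assms(1) is_group assms(2,3) that]
      l_repr_independence assms by blast
qed

lemma mem_conj_iff:
  assumes "H \<subseteq> carrier G" "a \<in> carrier G" "g \<in> carrier G"
  shows "g \<in> a <# H #> inv a \<longleftrightarrow> inv a \<otimes> g \<otimes> a \<in> H"
proof
  assume "g \<in> a <# H #> inv a"
  then obtain h where h: "h \<in> H" "g = a \<otimes> h \<otimes> inv a" by (auto simp: l_coset_def r_coset_def)
  then have "inv a \<otimes> g \<otimes> a = h" using assms by (metis inv_solve_left' inv_solve_right m_assoc inv_closed m_closed subsetD)
  then show "inv a \<otimes> g \<otimes> a \<in> H" using h by simp
next
  assume h: "inv a \<otimes> g \<otimes> a \<in> H"
  have "g = a \<otimes> (inv a \<otimes> g \<otimes> a) \<otimes> inv a"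
    using assms by (simp add: m_assoc) (simp add: m_assoc[symmetric])
  then show "g \<in> a <# H #> inv a" using h by (auto simp: l_coset_def r_coset_def)
qed

text \<open>An element g fixes the coset aH exactly when its conjugate by the inverse of a lies in
  H. Both the diagonal form of the stabilizer counts and the isomorphism of G/H with G/H' for
  conjugate H, H' rest on this.\<close>

lemma stabilizer_coset:
  assumes "subgroup H G" "a \<in> carrier G"
  shows "stabilizer G (coset_action G H) (a <# H) = a <# H #> inv a"
proof -
  have sub: "H \<subseteq> carrier G" using assms(1) by (rule subgroup.subset)
  have "g \<otimes> a <# H = a <# H \<longleftrightarrow> g \<in> a <# H #> inv a" if "g \<in> carrier G" for g
    using that assms mem_conj_iff[OF sub assms(2) that] l_coset_eq_iff[OF assms(1,2), of "g \<otimes> a"]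
    by (auto simp: m_assoc)
  then have "stabilizer G (coset_action G H) (a <# H) = {g \<in> carrier G. g \<in> a <# H #> inv a}"
    using assms by (simp add: stabilizer_def coset_action_apply cong: conj_cong)
  moreover have "a <# H #> inv a \<subseteq> carrier G"
    using assms sub by (simp add: l_coset_subset_G r_coset_subset_G)
  ultimately show ?thesis by blast
qed

end

section \<open>Orbits as coset spaces, and splitting one off\<close>

context group_action
begin

lemma action_group: "group G"
  using group_hom group_hom.axioms(1) by blast

lemma orbit_subset: "x \<in> E \<Longrightarrow> orbit G \<phi> x \<subseteq> E"
  using element_image by (auto simp: orbit_def)

text \<open>Two elements move \<open>x\<close> to the same point exactly when their quotient fixes
  \<open>x\<close>. Describing cosets as fibres of the orbit map yields both directions of the
  isomorphism in \<open>coset_orbit_iso\<close>.\<close>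

lemma stabilizer_coset_eq_fibre:
  assumes "x \<in> E" "g \<in> carrier G"
  shows "g <# stabilizer G \<phi> x = {k \<in> carrier G. \<phi> k x = \<phi> g x}"
proof -
  interpret group G by (rule action_group)
  show ?thesis
  proof (intro equalityI subsetI)
    fix k assume "k \<in> g <# stabilizer G \<phi> x"
    then show "k \<in> {k \<in> carrier G. \<phi> k x = \<phi> g x}"
      using assms by (auto simp: l_coset_def stabilizer_def composition_rule)
  next
    fix k assume k: "k \<in> {k \<in> carrier G. \<phi> k x = \<phi> g x}"
    then have "\<phi> (inv g \<otimes> k) x = x"
      using assms orbit_sym_aux[OF assms(2,1)] by (simp add: composition_rule)
    then have "inv g \<otimes> k \<in> stabilizer G \<phi> x" using k assms by (simp add: stabilizer_def)
    moreover have "k = g \<otimes> (inv g \<otimes> k)" using k assms by (simp add: inv_solve_left' m_assoc[symmetric])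
    ultimately show "k \<in> g <# stabilizer G \<phi> x" by (auto simp: l_coset_def)
  qed
qed

lemma coset_orbit_iso:
  assumes x: "x \<in> E"
  defines "S \<equiv> stabilizer G \<phi> x"
  shows "gset_iso G (lcosets S) (coset_action G S) (orbit G \<phi> x) \<phi>"
proof -
  interpret group G by (rule action_group)
  have S: "subgroup S G" unfolding S_def by (rule stabilizer_subgroup[OF x])
  \<comment> \<open>The arbitrary representative does no harm: a coset is a fibre of the orbit map,
    so all its elements move \<open>x\<close> to the same point. The inverse \<open>f'\<close> sends
    a point to its fibre.\<close>
  define f where "f C = \<phi> (SOME g. g \<in> C) x" for C
  define f' where "f' y = {k \<in> carrier G. \<phi> k x = y}" for y
  have coset: "g <# S = f' (\<phi> g x)" if "g \<in> carrier G" for g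
    using stabilizer_coset_eq_fibre[OF x that] by (simp add: S_def f'_def)
  have f: "f (g <# S) = \<phi> g x" if "g \<in> carrier G" for g
  proof -
    have "g \<in> g <# S" using that by (simp add: coset f'_def)
    then have "(SOME k. k \<in> g <# S) \<in> g <# S" by (rule someI)
    then show ?thesis using that by (simp add: coset f'_def f_def)
  qed
  show ?thesis
  proof (rule gset_isoI[where f = f and f' = f'])
    fix C assume "C \<in> lcosets S"
    then obtain g where g: "g \<in> carrier G" "C = g <# S" by (auto simp: LCOSETS_def)
    then show "f C \<in> orbit G \<phi> x" by (auto simp: f orbit_def)
    show "f' (f C) = C" using g by (simp add: f coset[symmetric])
    show "f (coset_action G S k C) = \<phi> k (f C)" if "k \<in> carrier G" for k
      using that g x by (simp add: coset_action_apply S f composition_rule)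
  next
    fix y assume "y \<in> orbit G \<phi> x"
    then obtain g where g: "g \<in> carrier G" "y = \<phi> g x" by (auto simp: orbit_def)
    then show "f' y \<in> lcosets S" by (auto simp: LCOSETS_def coset[symmetric])
    show "f (f' y) = y" using g by (simp add: f coset[symmetric])
  qed
qed

text \<open>Orbits are symmetric and transitive: were the image of \<open>y\<close> in the orbit of
  \<open>x\<close>, then \<open>y\<close> would be as well.\<close>

lemma orbit_complement_closed:
  assumes "x \<in> E" "y \<in> E - orbit G \<phi> x" "g \<in> carrier G"
  shows "\<phi> g y \<in> E - orbit G \<phi> x"
proof -
  have yE: "\<phi> g y \<in> E" using assms element_image by blast
  have "y \<in> orbit G \<phi> (\<phi> g y)"
    using orbit_sym[OF _ yE] assms by (auto simp: orbit_def)
  then have "y \<in> orbit G \<phi> x" if "\<phi> g y \<in> orbit G \<phi> x"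
    using orbit_trans[OF assms(1) yE _ that] assms by blast
  then show ?thesis using assms yE by blast
qed

text \<open>The orbit is replaced by its coset space, the rest of \<open>E\<close> is kept. The
  action on the rest is cut down by \<open>restrict\<close>, since actions are extensional on the
  set they act on.\<close>

lemma gset_split_orbit:
  assumes "x \<in> E" "finite E"
  defines "S \<equiv> stabilizer G \<phi> x" and "R \<equiv> E - orbit G \<phi> x"
  defines "\<psi> \<equiv> \<lambda>g. restrict (\<phi> g) R"
  shows "finite_gset G R \<psi>"
    and "gset_iso G (lcosets S <+> R) (sum_action (lcosets S) (coset_action G S) R \<psi>) E \<phi>"
proof -
  interpret group G by (rule action_group)
  have closed: "\<phi> g y \<in> R" if "y \<in> R" "g \<in> carrier G" for g y
    using orbit_complement_closed assms(1) that by (simp add: R_def)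
  have R: "R \<subseteq> E" by (auto simp: R_def)
  show "finite_gset G R \<psi>"
    unfolding finite_gset_def
  proof
    show "group_action G R \<psi>"
      by (rule group_actionI[OF is_group])
        (use R closed in \<open>auto simp: \<psi>_def composition_rule subset_iff group_action_one[OF group_action_axioms]\<close>)
  qed (use assms(2) R finite_subset in blast)
  obtain f f' where f: "\<And>C. C \<in> lcosets S \<Longrightarrow> f C \<in> orbit G \<phi> x"
    "\<And>y. y \<in> orbit G \<phi> x \<Longrightarrow> f' y \<in> lcosets S"
    "\<And>C. C \<in> lcosets S \<Longrightarrow> f' (f C) = C" "\<And>y. y \<in> orbit G \<phi> x \<Longrightarrow> f (f' y) = y"
    "\<And>g C. g \<in> carrier G \<Longrightarrow> C \<in> lcosets S \<Longrightarrow> f (coset_action G S g C) = \<phi> g (f C)"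
    using coset_orbit_iso[OF assms(1)] unfolding S_def by (rule gset_isoE) blast
  show "gset_iso G (lcosets S <+> R) (sum_action (lcosets S) (coset_action G S) R \<psi>) E \<phi>"
    by (rule gset_isoI[where f = "case_sum f id" and
          f' = "\<lambda>y. if y \<in> orbit G \<phi> x then Inl (f' y) else Inr y"])
      (use f orbit_subset[OF assms(1)] in \<open>auto simp: R_def \<psi>_def InlI InrI\<close>)
qed

end

section \<open>The basis of transitive \<open>G\<close>-sets\<close>

context abelian_group
begin

context
  fixes k :: "'a \<Rightarrow> int"
  assumes k_add: "\<And>x y. x \<in> carrier G \<Longrightarrow> y \<in> carrier G \<Longrightarrow> k (x \<oplus> y) = k x + k y"
begin

lemma int_additive_zero: "k \<zero> = 0"
  using k_add[of \<zero> \<zero>] by simp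

lemma int_additive_add_pow:
  assumes "x \<in> carrier G"
  shows "k ([(n :: int)] \<cdot> x) = n * k x"
proof -
  \<comment> \<open>Integer multiples are powers in the additive group, so the power law for
    homomorphisms into \<open>integer_group\<close> applies.\<close>
  have "k \<in> hom (add_monoid G) integer_group" by (rule homI) (simp_all add: k_add)
  then show ?thesis
    using hom_int_pow[of k "add_monoid G" integer_group x n] assms a_group
    by (simp add: add_pow_def)
qed

lemma int_additive_finsum:
  assumes "finite I" "f \<in> I \<rightarrow> carrier G"
  shows "k (\<Oplus>i\<in>I. f i) = (\<Sum>i\<in>I. k (f i))"
  using assms by (induction I rule: finite_induct) (auto simp: int_additive_zero k_add finsum_closed Pi_def)

end

end

section \<open>Counting points by the conjugacy class of their stabilizer\<close>

definition stab_count ::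
    "('a, 'm) monoid_scheme \<Rightarrow> 'a set set \<Rightarrow> 'x set \<Rightarrow> ('a \<Rightarrow> 'x \<Rightarrow> 'x) \<Rightarrow> int" where
  "stab_count G K E \<phi> = int (card {x \<in> E. stabilizer G \<phi> x \<in> K})"

text \<open>The description picks the value shared by all models in the class; that they share it is
  \<open>stab_count_iso\<close>.\<close>

definition class_stab_count :: "('a, 'm) monoid_scheme \<Rightarrow> 'a set set \<Rightarrow> 'a gset_class \<Rightarrow> int" where
  "class_stab_count G K P = (THE n. \<exists>D \<phi>. (D, \<phi>) \<in> P \<and> n = stab_count G K D \<phi>)"

text \<open>An equivariant injection preserves each stabilizer itself, not only its conjugacy class,
  so it matches up the counted points.\<close>

lemma stab_count_iso:
  assumes act: "group_action G E \<phi>" and iso: "gset_iso G E \<phi> F \<psi>"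
  shows "stab_count G K E \<phi> = stab_count G K F \<psi>"
proof -
  obtain f where f: "bij_betw f E F" "\<forall>g\<in>carrier G. \<forall>x\<in>E. f (\<phi> g x) = \<psi> g (f x)"
    using iso by (auto simp: gset_iso_def)
  have stab: "stabilizer G \<psi> (f x) = stabilizer G \<phi> x" if "x \<in> E" for x
  proof -
    have "\<psi> g (f x) = f x \<longleftrightarrow> \<phi> g x = x" if "g \<in> carrier G" for g
      using f that \<open>x \<in> E\<close> group_action_closed[OF act that] by (metis bij_betw_def inj_onD)
    then show ?thesis by (simp add: stabilizer_def cong: conj_cong)
  qed
  have "bij_betw f {x \<in> E. stabilizer G \<phi> x \<in> K} {y \<in> F. stabilizer G \<psi> y \<in> K}"
    using f(1) stab by (intro bij_betw_Collect) auto
  then show ?thesis by (simp add: stab_count_def bij_betw_same_card)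
qed

lemma class_stab_count_eq:
  assumes "finite_gset G E \<phi>"
  shows "class_stab_count G K (gset_class G E \<phi>) = stab_count G K E \<phi>"
proof -
  have act: "group_action G E \<phi>" using assms by (rule finite_gset_action)
  obtain D :: "nat set" and \<psi> where "finite_gset G D \<psi>" "gset_iso G E \<phi> D \<psi>"
    using assms by (rule gset_class_exhaust)
  then have D: "(D, \<psi>) \<in> gset_class G E \<phi>" by (simp add: gset_class_def)
  have const: "stab_count G K D' \<psi>' = stab_count G K E \<phi>" if "(D', \<psi>') \<in> gset_class G E \<phi>" for D' \<psi>'
    by (rule stab_count_iso[OF act, symmetric]) (use that in \<open>simp add: gset_class_def\<close>)
  show ?thesis unfolding class_stab_count_def
  proof (rule the_equality)
    show "\<exists>D' \<psi>'. (D', \<psi>') \<in> gset_class G E \<phi> \<and> stab_count G K E \<phi> = stab_count G K D' \<psi>'"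
      using D const[OF D] by metis
  qed (use const in blast)
qed

lemma stab_count_sum:
  assumes "finite D" "finite E"
  shows "stab_count G K (D <+> E) (sum_action D \<phi> E \<psi>) = stab_count G K D \<phi> + stab_count G K E \<psi>"
proof -
  let ?s = "stabilizer G (sum_action D \<phi> E \<psi>)"
  have "?s (Inl x) = stabilizer G \<phi> x" if "x \<in> D" for x
    using that by (simp add: stabilizer_def)
  moreover have "?s (Inr y) = stabilizer G \<psi> y" if "y \<in> E" for y
    using that by (simp add: stabilizer_def)
  ultimately have "{z \<in> D <+> E. ?s z \<in> K} =
      {x \<in> D. stabilizer G \<phi> x \<in> K} <+> {y \<in> E. stabilizer G \<psi> y \<in> K}" by auto
  then show ?thesis using assms by (simp add: stab_count_def card_Plus)
qed

text \<open>The stabilizers of the cosets are conjugates of \<open>H\<close>, so either all of them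
  lie in the class \<open>K\<close> or none does.\<close>

lemma (in group) stab_count_coset:
  assumes "K \<in> subgroup_conj_classes G" "subgroup H G"
  shows "stab_count G K (lcosets H) (coset_action G H) = (if H \<in> K then int (card (lcosets H)) else 0)"
proof -
  have "stabilizer G (coset_action G H) C \<in> K \<longleftrightarrow> H \<in> K" if C: "C \<in> lcosets H" for C
  proof -
    obtain a where a: "a \<in> carrier G" "C = a <# H" using C by (auto simp: LCOSETS_def)
    have conj: "a <# H #> inv a \<in> subgroup_conj_class G H"
      using a by (auto simp: subgroup_conj_class_def)
    show ?thesis
      unfolding a(2) stabilizer_coset[OF assms(2) a(1)]
      using subgroup_conj_classes_mem_iff[OF assms(1)] subgroup_conj_class_subgroup[OF assms(2) conj]
        subgroup_conj_class_eq[OF assms(2) conj] assms(2) by metis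
  qed
  then have "{C \<in> lcosets H. stabilizer G (coset_action G H) C \<in> K} = (if H \<in> K then lcosets H else {})"
    by auto
  then show ?thesis by (simp add: stab_count_def)
qed

section \<open>Generation of the Burnside ring by transitive G-sets\<close>

definition virtual_gset ::
    "('a, 'm) monoid_scheme \<Rightarrow> 'x set \<Rightarrow> ('a \<Rightarrow> 'x \<Rightarrow> 'x) \<Rightarrow> 'a burnside" where
  "virtual_gset G E \<phi> = grothendieck_diff (gset_semiring G) (gset_class G E \<phi>) \<zero>\<^bsub>gset_semiring G\<^esub>"

lemma transitive_gset_virtual:
  "transitive_gset G H = virtual_gset G (lcosets\<^bsub>G\<^esub> H) (coset_action G H)"
  by (simp add: transitive_gset_def virtual_gset_def)

locale finite_group = group +
  assumes finite_carrier: "finite (carrier G)"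

sublocale finite_group \<subseteq> gsets: abelian_monoid "gset_semiring G"
  by (rule abelian_monoid_gset_semiring[OF is_group])

sublocale finite_group \<subseteq> burnside: abelian_group "burnside_ring G"
  unfolding burnside_ring_def by (rule gsets.abelian_group_grothendieck)

context finite_group
begin

lemma virtual_gset_closed: "finite_gset G E \<phi> \<Longrightarrow> virtual_gset G E \<phi> \<in> carrier (burnside_ring G)"
  by (simp add: virtual_gset_def burnside_ring_def gsets.grothendieck_diff_closed gset_class_closed)

lemma virtual_gset_iso:
  "finite_gset G E \<phi> \<Longrightarrow> gset_iso G E \<phi> F \<psi> \<Longrightarrow> virtual_gset G E \<phi> = virtual_gset G F \<psi>"
  by (simp add: virtual_gset_def gset_class_eq[OF finite_gset_action])

lemma virtual_gset_sum:
  assumes "finite_gset G D \<phi>" "finite_gset G E \<psi>"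
  shows "virtual_gset G (D <+> E) (sum_action D \<phi> E \<psi>) =
    virtual_gset G D \<phi> \<oplus>\<^bsub>burnside_ring G\<^esub> virtual_gset G E \<psi>"
  using assms
  by (simp add: virtual_gset_def burnside_ring_def gsets.grothendieck_diff_add gset_class_closed
      flip: gset_class_add)

lemma transitive_gset_closed:
  "subgroup H G \<Longrightarrow> transitive_gset G H \<in> carrier (burnside_ring G)"
  by (simp add: transitive_gset_virtual virtual_gset_closed finite_gset_coset finite_carrier)

text \<open>G/H is a single orbit, and its point aH has stabilizer \<open>a <# H #> inv a\<close>.
  Orbit-stabilizer at that point identifies the coset space of the conjugate with G/H.\<close>

lemma transitive_gset_conj:
  assumes "subgroup H G" "H' \<in> subgroup_conj_class G H"
  shows "transitive_gset G H' = transitive_gset G H"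
proof -
  obtain a where a: "a \<in> carrier G" "H' = a <# H #> inv a"
    using assms(2) by (auto simp: subgroup_conj_class_def)
  interpret act: group_action G "lcosets H" "coset_action G H"
    using finite_gset_coset[OF finite_carrier assms(1)] by (rule finite_gset_action)
  have mem: "a <# H \<in> lcosets H" using a by (auto simp: LCOSETS_def)
  have "lcosets H \<subseteq> orbit G (coset_action G H) (a <# H)"
  proof
    fix C assume "C \<in> lcosets H"
    then obtain b where b: "b \<in> carrier G" "C = b <# H" by (auto simp: LCOSETS_def)
    then have "C = coset_action G H (b \<otimes> inv a) (a <# H)"
      using a assms(1) by (simp add: coset_action_apply m_assoc)
    then show "C \<in> orbit G (coset_action G H) (a <# H)"
      using a b unfolding orbit_def by blast
  qed
  then have orb: "orbit G (coset_action G H) (a <# H) = lcosets H"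
    using act.orbit_subset[OF mem] by blast
  have "gset_iso G (lcosets H') (coset_action G H') (lcosets H) (coset_action G H)"
    using act.coset_orbit_iso[OF mem] unfolding orb stabilizer_coset[OF assms(1) a(1)] a(2) .
  then show ?thesis
    unfolding transitive_gset_virtual
    by (rule virtual_gset_iso[OF finite_gset_coset[OF finite_carrier subgroup_conj_class_subgroup[OF assms]]])
qed

text \<open>Strong induction on the number of points, removing the orbit of one point. The
  complement of an orbit is again a set of naturals, so the induction stays within one type; the
  coset space enters only as a summand.\<close>

lemma virtual_gset_induct:
  fixes E :: "nat set"
  assumes "finite_gset G E \<phi>"
    and zero: "P \<zero>\<^bsub>burnside_ring G\<^esub>"
    and trans: "\<And>H. subgroup H G \<Longrightarrow> P (transitive_gset G H)"
    and add: "\<And>x y. x \<in> carrier (burnside_ring G) \<Longrightarrow> y \<in> carrier (burnside_ring G) \<Longrightarrow>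
      P x \<Longrightarrow> P y \<Longrightarrow> P (x \<oplus>\<^bsub>burnside_ring G\<^esub> y)"
  shows "P (virtual_gset G E \<phi>)"
  using assms(1)
proof (induction "card E" arbitrary: E \<phi> rule: less_induct)
  case less
  interpret act: group_action G E \<phi> using less.prems by (rule finite_gset_action)
  have fin: "finite E" using less.prems by (simp add: finite_gset_def)
  show ?case
  proof (cases "E = {}")
    case True
    \<comment> \<open>Zero is defined by the empty subset of \<open>unit\<close>, so an empty set of
      naturals has to be identified with it across types.\<close>
    then have "gset_iso G E \<phi> ({} :: unit set) (\<lambda>g. \<lambda>x\<in>{}. x)"
      by (intro gset_isoI[where f = "\<lambda>_. ()" and f' = "\<lambda>_. 0"]) auto
    then have "virtual_gset G E \<phi> = \<zero>\<^bsub>burnside_ring G\<^esub>"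
      using virtual_gset_iso[OF less.prems, of "{} :: unit set" "\<lambda>g. \<lambda>x\<in>{}. x"]
      by (simp add: virtual_gset_def burnside_ring_def gsets.grothendieck_zero gset_semiring_zero)
    then show ?thesis using zero by simp
  next
    case False
    then obtain x where x: "x \<in> E" by blast
    let ?R = "E - orbit G \<phi> x" and ?S = "stabilizer G \<phi> x"
    let ?\<psi> = "\<lambda>g. restrict (\<phi> g) ?R"
    note split = act.gset_split_orbit[OF x fin]
    have S: "subgroup ?S G" by (rule act.stabilizer_subgroup[OF x])
    note cos = finite_gset_coset[OF finite_carrier S]
    have "card ?R < card E"
      using x act.orbit_refl[OF x] fin by (intro psubset_card_mono) auto
    then have "P (virtual_gset G ?R ?\<psi>)" using less.hyps split(1) by blast
    moreover have "virtual_gset G E \<phi> = transitive_gset G ?S \<oplus>\<^bsub>burnside_ring G\<^esub> virtual_gset G ?R ?\<psi>"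
      unfolding transitive_gset_virtual virtual_gset_sum[OF cos split(1), symmetric]
      by (rule virtual_gset_iso[OF finite_gset_sum[OF cos split(1)] split(2), symmetric])
    ultimately show ?thesis
      using add[OF transitive_gset_closed[OF S] virtual_gset_closed[OF split(1)]] trans[OF S] by simp
  qed
qed

text \<open>Every element is a formal difference of two G-sets, each of which is a sum of transitive
  ones.\<close>

lemma burnside_induct [consumes 1, case_names transitive add neg]:
  assumes "x \<in> carrier (burnside_ring G)"
    and trans: "\<And>H. subgroup H G \<Longrightarrow> P (transitive_gset G H)"
    and add: "\<And>x y. x \<in> carrier (burnside_ring G) \<Longrightarrow> y \<in> carrier (burnside_ring G) \<Longrightarrow>
      P x \<Longrightarrow> P y \<Longrightarrow> P (x \<oplus>\<^bsub>burnside_ring G\<^esub> y)"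
    and neg: "\<And>x. x \<in> carrier (burnside_ring G) \<Longrightarrow> P x \<Longrightarrow> P (\<ominus>\<^bsub>burnside_ring G\<^esub> x)"
  shows "P x"
proof -
  let ?t = "transitive_gset G (carrier G)"
  have t: "?t \<in> carrier (burnside_ring G)" by (rule transitive_gset_closed[OF subgroup_self])
  \<comment> \<open>Zero has no case of its own; it is obtained as [G/G] - [G/G].\<close>
  have "P (?t \<oplus>\<^bsub>burnside_ring G\<^esub> \<ominus>\<^bsub>burnside_ring G\<^esub> ?t)"
    using t by (intro add neg trans subgroup_self) auto
  then have zero: "P \<zero>\<^bsub>burnside_ring G\<^esub>" using t by (simp add: burnside.r_neg)
  obtain a b where ab: "a \<in> carrier (gset_semiring G)" "b \<in> carrier (gset_semiring G)"
    "x = grothendieck_diff (gset_semiring G) a b"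
    using assms(1) gsets.grothendieck_ring_cases unfolding burnside_ring_def by metis
  obtain D :: "nat set" and \<phi> where D: "finite_gset G D \<phi>" "a = gset_class G D \<phi>"
    using ab(1) by (rule gset_semiring_cases)
  obtain E :: "nat set" and \<psi> where E: "finite_gset G E \<psi>" "b = gset_class G E \<psi>"
    using ab(2) by (rule gset_semiring_cases)
  have "x = virtual_gset G D \<phi> \<oplus>\<^bsub>burnside_ring G\<^esub> \<ominus>\<^bsub>burnside_ring G\<^esub> virtual_gset G E \<psi>"
    using ab D E by (simp add: virtual_gset_def burnside_ring_def gsets.grothendieck_diff_neg
        gsets.grothendieck_diff_add)
  moreover have "P (virtual_gset G D \<phi>)" "P (virtual_gset G E \<psi>)"
    using virtual_gset_induct[OF D(1) zero trans add] virtual_gset_induct[OF E(1) zero trans add] by blast+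
  ultimately show ?thesis using add neg virtual_gset_closed[OF D(1)] virtual_gset_closed[OF E(1)] by simp
qed

text \<open>Up to the factor |G/H|, this \<open>k\<close> is the coordinate functional belonging to
  the class \<open>K\<close>, obtained without knowing yet that coordinates exist.\<close>

lemma ex_additive_stab_count:
  assumes K: "K \<in> subgroup_conj_classes G"
  obtains k :: "'a burnside \<Rightarrow> int" where
    "\<And>x y. x \<in> carrier (burnside_ring G) \<Longrightarrow> y \<in> carrier (burnside_ring G) \<Longrightarrow>
      k (x \<oplus>\<^bsub>burnside_ring G\<^esub> y) = k x + k y"
    "\<And>H. subgroup H G \<Longrightarrow>
      k (transitive_gset G H) = (if H \<in> K then int (card (lcosets H)) else 0)"
proof -
  let ?h = "class_stab_count G K"
  have h: "?h (a \<oplus>\<^bsub>gset_semiring G\<^esub> b) = ?h a + ?h b"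
    if a: "a \<in> carrier (gset_semiring G)" and b: "b \<in> carrier (gset_semiring G)" for a b
  proof -
    obtain D :: "nat set" and \<phi> where D: "finite_gset G D \<phi>" "a = gset_class G D \<phi>"
      using a by (rule gset_semiring_cases)
    obtain E :: "nat set" and \<psi> where E: "finite_gset G E \<psi>" "b = gset_class G E \<psi>"
      using b by (rule gset_semiring_cases)
    have "finite D" "finite E" using D E by (simp_all add: finite_gset_def)
    then show ?thesis
      using D E by (simp add: gset_class_add class_stab_count_eq finite_gset_sum stab_count_sum)
  qed
  obtain k where k: "\<And>a b. a \<in> carrier (gset_semiring G) \<Longrightarrow> b \<in> carrier (gset_semiring G) \<Longrightarrow>
      k (grothendieck_diff (gset_semiring G) a b) = ?h a - ?h b"
    "\<And>x y. x \<in> carrier (burnside_ring G) \<Longrightarrow> y \<in> carrier (burnside_ring G) \<Longrightarrow>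
      k (x \<oplus>\<^bsub>burnside_ring G\<^esub> y) = k x + k y"
    using gsets.grothendieck_extend_additive[of ?h, OF h] unfolding burnside_ring_def by blast
  \<comment> \<open>\<open>transitive_gset\<close> is a difference with subtrahend zero, so
    \<open>k\<close> subtracts this value.\<close>
  have "?h \<zero>\<^bsub>gset_semiring G\<^esub> = 0"
    using h[of "\<zero>\<^bsub>gset_semiring G\<^esub>" "\<zero>\<^bsub>gset_semiring G\<^esub>"] by simp
  then have "k (transitive_gset G H) = (if H \<in> K then int (card (lcosets H)) else 0)"
    if "subgroup H G" for H
    using k(1) gset_class_closed[OF finite_gset_coset[OF finite_carrier that]]
      class_stab_count_eq[OF finite_gset_coset[OF finite_carrier that]] stab_count_coset[OF K that]
    by (simp add: transitive_gset_def)
  then show ?thesis using that k(2) by blast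
qed

end

section \<open>Integer combinations in an abelian group\<close>

context abelian_group
begin

lemma add_pow_closed: "x \<in> carrier G \<Longrightarrow> [(n :: int)] \<cdot> x \<in> carrier G"
  using group.int_pow_closed[OF a_group] by (simp add: add_pow_def)

lemma add_pow_add: "x \<in> carrier G \<Longrightarrow> [(m + n :: int)] \<cdot> x = [m] \<cdot> x \<oplus> [n] \<cdot> x"
  using group.int_pow_mult[OF a_group, of x m n] by (simp add: add_pow_def)

lemma add_pow_distrib:
  "x \<in> carrier G \<Longrightarrow> y \<in> carrier G \<Longrightarrow> [(n :: int)] \<cdot> (x \<oplus> y) = [n] \<cdot> x \<oplus> [n] \<cdot> y"
  using comm_group.int_pow_distrib[OF a_comm_group, of x y n] by (simp add: add_pow_def)

lemma finsum_add_pow_closed: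
  "t \<in> I \<rightarrow> carrier G \<Longrightarrow> (\<Oplus>i\<in>I. [(a i :: int)] \<cdot> t i) \<in> carrier G"
  by (intro finsum_closed) (auto simp: add_pow_closed Pi_iff)

lemma finsum_add_pow_add:
  assumes "t \<in> I \<rightarrow> carrier G"
  shows "(\<Oplus>i\<in>I. [(a i + b i :: int)] \<cdot> t i) = (\<Oplus>i\<in>I. [a i] \<cdot> t i) \<oplus> (\<Oplus>i\<in>I. [b i] \<cdot> t i)"
proof -
  have "(\<Oplus>i\<in>I. [(a i + b i)] \<cdot> t i) = (\<Oplus>i\<in>I. [a i] \<cdot> t i \<oplus> [b i] \<cdot> t i)"
    by (rule finsum_cong') (use assms in \<open>auto simp: add_pow_add add_pow_closed Pi_iff\<close>)
  also have "\<dots> = (\<Oplus>i\<in>I. [a i] \<cdot> t i) \<oplus> (\<Oplus>i\<in>I. [b i] \<cdot> t i)"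
    using assms by (intro finsum_addf) (auto simp: add_pow_closed Pi_iff)
  finally show ?thesis .
qed

lemma finsum_add_pow_distrib:
  assumes "t \<in> I \<rightarrow> carrier G" "u \<in> I \<rightarrow> carrier G"
  shows "(\<Oplus>i\<in>I. [(a i :: int)] \<cdot> (t i \<oplus> u i)) = (\<Oplus>i\<in>I. [a i] \<cdot> t i) \<oplus> (\<Oplus>i\<in>I. [a i] \<cdot> u i)"
proof -
  have "(\<Oplus>i\<in>I. [a i] \<cdot> (t i \<oplus> u i)) = (\<Oplus>i\<in>I. [a i] \<cdot> t i \<oplus> [a i] \<cdot> u i)"
    by (rule finsum_cong') (use assms in \<open>auto simp: add_pow_distrib add_pow_closed Pi_iff\<close>)
  also have "\<dots> = (\<Oplus>i\<in>I. [a i] \<cdot> t i) \<oplus> (\<Oplus>i\<in>I. [a i] \<cdot> u i)"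
    using assms by (intro finsum_addf) (auto simp: add_pow_closed Pi_iff)
  finally show ?thesis .
qed

lemma finsum_add_pow_single:
  assumes "finite I" "t \<in> I \<rightarrow> carrier G" "j \<in> I"
  shows "(\<Oplus>i\<in>I. [(if i = j then 1 else 0 :: int)] \<cdot> t i) = t j"
proof -
  have "(\<Oplus>i\<in>I. [(if i = j then 1 else 0 :: int)] \<cdot> t i) = (\<Oplus>i\<in>I. if j = i then t i else \<zero>)"
    by (rule finsum_cong')
      (use assms in \<open>auto simp: add_pow_def group.int_pow_1[OF a_group] Pi_iff\<close>)
  also have "\<dots> = t j" using assms by (intro finsum_singleton) auto
  finally show ?thesis .
qed

lemma finsum_add_pow_neg:
  assumes "t \<in> I \<rightarrow> carrier G"
  shows "(\<Oplus>i\<in>I. [(- a i :: int)] \<cdot> t i) = \<ominus> (\<Oplus>i\<in>I. [a i] \<cdot> t i)"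
proof -
  have "(\<Oplus>i\<in>I. [(- a i + a i :: int)] \<cdot> t i) = \<zero>"
    using add.finprod_one_eqI[of I "\<lambda>i. [(- a i + a i :: int)] \<cdot> t i"] by (simp add: add_pow_def)
  then show ?thesis
    using finsum_add_pow_add[OF assms, of "\<lambda>i. - a i" a] finsum_add_pow_closed[OF assms]
    by (simp add: minus_equality)
qed

end

section \<open>The basis, its coefficients and linear extension\<close>

definition linear_extension ::
    "('a, 'm) monoid_scheme \<Rightarrow> ('c, 'n) ring_scheme \<Rightarrow> ('a set \<Rightarrow> 'c) \<Rightarrow> 'a burnside \<Rightarrow> 'c" where
  "linear_extension G A t x =
    (\<Oplus>\<^bsub>A\<^esub>K\<in>subgroup_conj_classes G. [burnside_coeffs G x K] \<cdot>\<^bsub>A\<^esub> t (SOME H. H \<in> K))"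

context finite_group
begin

abbreviation "combination a \<equiv> (\<Oplus>\<^bsub>burnside_ring G\<^esub>K\<in>subgroup_conj_classes G.
  [a K] \<cdot>\<^bsub>burnside_ring G\<^esub> transitive_gset G (SOME H. H \<in> K))"

lemma finite_conj_classes: "finite (subgroup_conj_classes G)"
  by (rule finite_subgroup_conj_classes[OF finite_carrier])

lemma conj_class_in_classes: "subgroup H G \<Longrightarrow> subgroup_conj_class G H \<in> subgroup_conj_classes G"
  by (auto simp: subgroup_conj_classes_def)

lemma representative_subgroup: "K \<in> subgroup_conj_classes G \<Longrightarrow> subgroup (SOME H. H \<in> K) G"
  using subgroup_conj_classes_mem(1) subgroup_conj_classes_some by blast

lemma representatives_funcset:
  assumes "\<And>H. subgroup H G \<Longrightarrow> t H \<in> A"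
  shows "(\<lambda>K. t (SOME H. H \<in> K)) \<in> subgroup_conj_classes G \<rightarrow> A"
  using assms representative_subgroup by blast

lemmas transitive_funcset = representatives_funcset[of "transitive_gset G", OF transitive_gset_closed]

lemma representative_transitive:
  assumes "subgroup H G"
  shows "transitive_gset G (SOME H'. H' \<in> subgroup_conj_class G H) = transitive_gset G H"
  using transitive_gset_conj[OF assms subgroup_conj_classes_some[OF conj_class_in_classes[OF assms]]] .

lemma transitive_combination:
  assumes "subgroup H G"
  shows "transitive_gset G H = combination (\<lambda>K. if K = subgroup_conj_class G H then 1 else 0 :: int)"
  using burnside.finsum_add_pow_single[OF finite_conj_classes transitive_funcset conj_class_in_classes[OF assms]]
  by (simp add: representative_transitive[OF assms])

lemma ex_combination:
  assumes "x \<in> carrier (burnside_ring G)"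
  shows "\<exists>a :: 'a set set \<Rightarrow> int. x = combination a"
  using assms
proof (induction x rule: burnside_induct)
  case (transitive H)
  show ?case
    by (intro exI[of _ "\<lambda>K. if K = subgroup_conj_class G H then 1 else 0"]
        transitive_combination[OF transitive])
next
  case (add x y)
  then obtain a b :: "'a set set \<Rightarrow> int" where "x = combination a" "y = combination b" by blast
  then have "x \<oplus>\<^bsub>burnside_ring G\<^esub> y = combination (\<lambda>K. a K + b K)"
    using burnside.finsum_add_pow_add[OF transitive_funcset, of a b] by simp
  then show ?case by (intro exI[of _ "\<lambda>K. a K + b K"])
next
  case (neg x)
  then obtain a :: "'a set set \<Rightarrow> int" where "x = combination a" by blast
  then have "\<ominus>\<^bsub>burnside_ring G\<^esub> x = combination (\<lambda>K. - a K)"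
    using burnside.finsum_add_pow_neg[OF transitive_funcset, of a] by simp
  then show ?case by (intro exI[of _ "\<lambda>K. - a K"])
qed

text \<open>The functional attached to \<open>K\<close> kills every term except the one at
  \<open>K\<close>, and multiplies that coefficient by the index of the representative.\<close>

lemma combination_inject:
  fixes a b :: "'a set set \<Rightarrow> int"
  assumes "combination a = combination b" "K \<in> subgroup_conj_classes G"
  shows "a K = b K"
proof -
  let ?H = "SOME H. H \<in> K"
  obtain k :: "'a burnside \<Rightarrow> int" where
    k: "\<And>x y. x \<in> carrier (burnside_ring G) \<Longrightarrow> y \<in> carrier (burnside_ring G) \<Longrightarrow>
      k (x \<oplus>\<^bsub>burnside_ring G\<^esub> y) = k x + k y"
    "\<And>H. subgroup H G \<Longrightarrow>
      k (transitive_gset G H) = (if H \<in> K then int (card (lcosets H)) else 0)"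
    using ex_additive_stab_count[OF assms(2)] by blast
  have k_combination: "k (combination c) = c K * int (card (lcosets ?H))" for c :: "'a set set \<Rightarrow> int"
  proof -
    have "k (combination c) = (\<Sum>L\<in>subgroup_conj_classes G.
        k ([c L] \<cdot>\<^bsub>burnside_ring G\<^esub> transitive_gset G (SOME H. H \<in> L)))"
      by (rule burnside.int_additive_finsum[OF k(1) finite_conj_classes])
        (use transitive_funcset burnside.add_pow_closed in blast)+
    also have "\<dots> = (\<Sum>L\<in>subgroup_conj_classes G. if L = K then c L * int (card (lcosets ?H)) else 0)"
    proof (rule sum.cong[OF refl])
      fix L assume L: "L \<in> subgroup_conj_classes G"
      have "(SOME H. H \<in> L) \<in> K \<longleftrightarrow> L = K"
        using subgroup_conj_classes_mem(2)[OF L subgroup_conj_classes_some[OF L]]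
          subgroup_conj_classes_mem_iff[OF assms(2) representative_subgroup[OF L]] by auto
      then show "k ([c L] \<cdot>\<^bsub>burnside_ring G\<^esub> transitive_gset G (SOME H. H \<in> L)) =
          (if L = K then c L * int (card (lcosets ?H)) else 0)"
        using burnside.int_additive_add_pow[OF k(1) transitive_gset_closed[OF representative_subgroup[OF L]]]
          k(2)[OF representative_subgroup[OF L]] by simp
    qed
    also have "\<dots> = c K * int (card (lcosets ?H))"
      using assms(2) finite_conj_classes by simp
    finally show ?thesis .
  qed
  have "a K * int (card (lcosets ?H)) = b K * int (card (lcosets ?H))"
    using arg_cong[OF assms(1), of k] unfolding k_combination[of a] k_combination[of b] .
  \<comment> \<open>A nonzero index can be cancelled in the integers; it is positive because the
    coset space is finite and inhabited.\<close>
  moreover have "card (lcosets ?H) \<noteq> 0"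
  proof -
    have "finite (lcosets ?H)"
      using finite_gset_coset[OF finite_carrier representative_subgroup[OF assms(2)]]
      by (simp add: finite_gset_def)
    moreover have "lcosets ?H \<noteq> {}" by (auto simp: LCOSETS_def)
    ultimately show ?thesis by simp
  qed
  ultimately show ?thesis by simp
qed

lemma combination_burnside_coeffs:
  assumes "x \<in> carrier (burnside_ring G)"
  shows "combination (burnside_coeffs G x) = x"
proof -
  obtain a :: "'a set set \<Rightarrow> int" where a: "x = combination a" using ex_combination[OF assms] by blast
  \<comment> \<open>The description asks for an extensional coefficient function; values outside the
    set of conjugacy classes would otherwise spoil uniqueness.\<close>
  let ?a = "restrict a (subgroup_conj_classes G)"
  have eq: "x = combination ?a"
    unfolding a
    by (rule burnside.finsum_cong') (use burnside.add_pow_closed transitive_funcset in auto)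
  have "\<exists>!c :: 'a set set \<Rightarrow> int. c \<in> extensional (subgroup_conj_classes G) \<and> x = combination c"
  proof
    show "?a \<in> extensional (subgroup_conj_classes G) \<and> x = combination ?a" using eq by simp
    fix c :: "'a set set \<Rightarrow> int" assume c: "c \<in> extensional (subgroup_conj_classes G) \<and> x = combination c"
    then show "c = ?a"
      using combination_inject[of c ?a] eq by (intro extensionalityI[of c]) auto
  qed
  from theI'[OF this] show ?thesis unfolding burnside_coeffs_def by simp
qed

lemma burnside_coeffs_combination:
  fixes a :: "'a set set \<Rightarrow> int"
  assumes "K \<in> subgroup_conj_classes G"
  shows "burnside_coeffs G (combination a) K = a K"
  using assms combination_inject combination_burnside_coeffs[OF burnside.finsum_add_pow_closed[OF transitive_funcset]]
  by blast

lemma burnside_coeffs_add: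
  assumes "x \<in> carrier (burnside_ring G)" "y \<in> carrier (burnside_ring G)" "K \<in> subgroup_conj_classes G"
  shows "burnside_coeffs G (x \<oplus>\<^bsub>burnside_ring G\<^esub> y) K = burnside_coeffs G x K + burnside_coeffs G y K"
proof -
  have "x \<oplus>\<^bsub>burnside_ring G\<^esub> y = combination (\<lambda>K. burnside_coeffs G x K + burnside_coeffs G y K)"
    using burnside.finsum_add_pow_add[OF transitive_funcset, of "burnside_coeffs G x" "burnside_coeffs G y"]
    by (simp add: combination_burnside_coeffs assms)
  then show ?thesis using burnside_coeffs_combination[OF assms(3)] by simp
qed

lemma burnside_coeffs_transitive:
  assumes "subgroup H G" "K \<in> subgroup_conj_classes G"
  shows "burnside_coeffs G (transitive_gset G H) K = (if K = subgroup_conj_class G H then 1 else 0)"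
  unfolding transitive_combination[OF assms(1)] by (rule burnside_coeffs_combination[OF assms(2)])

text \<open>The elements on which two homomorphisms agree are closed under sums and, the target
  being a group, under negation, so \<open>burnside_induct\<close> applies. The multiplicative
  target covers both \<open>add_monoid\<close> and \<open>integer_group\<close>.\<close>

lemma burnside_hom_eq:
  assumes "group M" and f: "f \<in> hom (add_monoid (burnside_ring G)) M" and g: "g \<in> hom (add_monoid (burnside_ring G)) M"
    and eq: "\<And>H. subgroup H G \<Longrightarrow> f (transitive_gset G H) = g (transitive_gset G H)"
    and x: "x \<in> carrier (burnside_ring G)"
  shows "f x = g x"
  using x
proof (induction x rule: burnside_induct)
  case (transitive H)
  then show ?case by (rule eq)
next
  case (add x y)
  then show ?case using hom_mult[OF f, of x y] hom_mult[OF g, of x y] by simp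
next
  case (neg x)
  interpret f: group_hom "add_monoid (burnside_ring G)" M f
    using burnside.a_group assms by (simp add: group_hom_def group_hom_axioms_def)
  interpret g: group_hom "add_monoid (burnside_ring G)" M g
    using burnside.a_group assms by (simp add: group_hom_def group_hom_axioms_def)
  show ?case using neg f.hom_inv[of x] g.hom_inv[of x] by (simp add: a_inv_def)
qed

context
  fixes A :: "('c, 'n) ring_scheme" and t :: "'a set \<Rightarrow> 'c"
  assumes A: "abelian_group A" and t: "\<And>H. subgroup H G \<Longrightarrow> t H \<in> carrier A"
begin

interpretation A: abelian_group A by (rule A)

lemma linear_extension_closed: "linear_extension G A t x \<in> carrier A"
  unfolding linear_extension_def by (rule A.finsum_add_pow_closed[OF representatives_funcset[OF t]])

lemma linear_extension_hom:
  "linear_extension G A t \<in> hom (add_monoid (burnside_ring G)) (add_monoid A)"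
proof (rule homI)
  fix x y assume xy: "x \<in> carrier (add_monoid (burnside_ring G))" "y \<in> carrier (add_monoid (burnside_ring G))"
  have "linear_extension G A t (x \<oplus>\<^bsub>burnside_ring G\<^esub> y) =
      (\<Oplus>\<^bsub>A\<^esub>K\<in>subgroup_conj_classes G.
        [(burnside_coeffs G x K + burnside_coeffs G y K)] \<cdot>\<^bsub>A\<^esub> t (SOME H. H \<in> K))"
    unfolding linear_extension_def
    by (rule A.finsum_cong')
      (use xy burnside_coeffs_add A.add_pow_closed t representative_subgroup in auto)
  also have "\<dots> = linear_extension G A t x \<oplus>\<^bsub>A\<^esub> linear_extension G A t y"
    unfolding linear_extension_def by (rule A.finsum_add_pow_add[OF representatives_funcset[OF t]])
  finally show "linear_extension G A t (x \<otimes>\<^bsub>add_monoid (burnside_ring G)\<^esub> y) =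
      linear_extension G A t x \<otimes>\<^bsub>add_monoid A\<^esub> linear_extension G A t y" by simp
qed (simp add: linear_extension_closed)

text \<open>The sum evaluates \<open>t\<close> at the chosen representative of the class of
  \<open>H\<close>. The hypothesis \<open>conj\<close> carries that value back to
  \<open>H\<close>.\<close>

lemma linear_extension_transitive:
  assumes H: "subgroup H G" and conj: "\<And>H'. H' \<in> subgroup_conj_class G H \<Longrightarrow> t H' = t H"
  shows "linear_extension G A t (transitive_gset G H) = t H"
proof -
  have "linear_extension G A t (transitive_gset G H) =
      (\<Oplus>\<^bsub>A\<^esub>K\<in>subgroup_conj_classes G.
        [(if K = subgroup_conj_class G H then 1 else 0 :: int)] \<cdot>\<^bsub>A\<^esub> t (SOME H. H \<in> K))"
    unfolding linear_extension_def
    by (rule A.finsum_cong')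
      (use H burnside_coeffs_transitive A.add_pow_closed t representative_subgroup in auto)
  also have "\<dots> = t (SOME H'. H' \<in> subgroup_conj_class G H)"
    by (rule A.finsum_add_pow_single[OF finite_conj_classes representatives_funcset[OF t] conj_class_in_classes[OF H]])
  also have "\<dots> = t H" by (rule conj[OF subgroup_conj_classes_some[OF conj_class_in_classes[OF H]]])
  finally show ?thesis .
qed

text \<open>Additivity in the prescribed values, with \<open>x\<close> fixed. It provides the second
  half of biadditivity when linear extensions are nested.\<close>

lemma linear_extension_add:
  assumes u: "\<And>H. subgroup H G \<Longrightarrow> u H \<in> carrier A"
  shows "linear_extension G A (\<lambda>H. t H \<oplus>\<^bsub>A\<^esub> u H) x =
    linear_extension G A t x \<oplus>\<^bsub>A\<^esub> linear_extension G A u x"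
  unfolding linear_extension_def
  by (rule A.finsum_add_pow_distrib[OF representatives_funcset[OF t] representatives_funcset[OF u]])

end

end

section \<open>The universal property of the tensor product\<close>

text \<open>The target is written multiplicatively so that it can be the additive group of a ring, a tensor
  product or \<^const>\<open>integer_group\<close>.\<close>

definition biadditive ::
    "('u, 'm) ring_scheme \<Rightarrow> ('v, 'n) ring_scheme \<Rightarrow> ('c, 'k) monoid_scheme \<Rightarrow> ('u \<Rightarrow> 'v \<Rightarrow> 'c) \<Rightarrow> bool" where
  "biadditive R S M \<beta> \<longleftrightarrow>
    (\<forall>b\<in>carrier S. (\<lambda>a. \<beta> a b) \<in> hom (add_monoid R) M) \<and>
    (\<forall>a\<in>carrier R. \<beta> a \<in> hom (add_monoid S) M)"

lemma biadditive_closed: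
  "biadditive R S M \<beta> \<Longrightarrow> a \<in> carrier R \<Longrightarrow> b \<in> carrier S \<Longrightarrow> \<beta> a b \<in> carrier M"
  using hom_in_carrier[of "\<beta> a" "add_monoid S" M b] by (simp add: biadditive_def)

lemma biadditive_left:
  "biadditive R S M \<beta> \<Longrightarrow> a \<in> carrier R \<Longrightarrow> a' \<in> carrier R \<Longrightarrow> b \<in> carrier S \<Longrightarrow>
    \<beta> (a \<oplus>\<^bsub>R\<^esub> a') b = \<beta> a b \<otimes>\<^bsub>M\<^esub> \<beta> a' b"
  using hom_mult[of "\<lambda>a. \<beta> a b" "add_monoid R" M a a'] by (simp add: biadditive_def)

lemma biadditive_right:
  "biadditive R S M \<beta> \<Longrightarrow> a \<in> carrier R \<Longrightarrow> b \<in> carrier S \<Longrightarrow> b' \<in> carrier S \<Longrightarrow>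
    \<beta> a (b \<oplus>\<^bsub>S\<^esub> b') = \<beta> a b \<otimes>\<^bsub>M\<^esub> \<beta> a b'"
  using hom_mult[of "\<beta> a" "add_monoid S" M b b'] by (simp add: biadditive_def)

lemma biadditiveI:
  assumes "\<And>a b. a \<in> carrier R \<Longrightarrow> b \<in> carrier S \<Longrightarrow> \<beta> a b \<in> carrier M"
    and "\<And>a a' b. a \<in> carrier R \<Longrightarrow> a' \<in> carrier R \<Longrightarrow> b \<in> carrier S \<Longrightarrow>
      \<beta> (a \<oplus>\<^bsub>R\<^esub> a') b = \<beta> a b \<otimes>\<^bsub>M\<^esub> \<beta> a' b"
    and "\<And>a b b'. a \<in> carrier R \<Longrightarrow> b \<in> carrier S \<Longrightarrow> b' \<in> carrier S \<Longrightarrow>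
      \<beta> a (b \<oplus>\<^bsub>S\<^esub> b') = \<beta> a b \<otimes>\<^bsub>M\<^esub> \<beta> a b'"
  shows "biadditive R S M \<beta>"
  using assms by (simp add: biadditive_def hom_def Pi_def)

lemma biadditive_compose:
  assumes "biadditive R S M \<beta>" "f \<in> hom M N"
  shows "biadditive R S N (\<lambda>a b. f (\<beta> a b))"
  using biadditive_closed[OF assms(1)] hom_in_carrier[OF assms(2)] hom_mult[OF assms(2)]
  by (intro biadditiveI) (simp_all add: biadditive_left[OF assms(1)] biadditive_right[OF assms(1)])

lemma biadditive_compose_args:
  assumes "biadditive R S M \<beta>" "f \<in> hom (add_monoid R') (add_monoid R)" "g \<in> hom (add_monoid S') (add_monoid S)"
  shows "biadditive R' S' M (\<lambda>a b. \<beta> (f a) (g b))"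
  using hom_in_carrier[OF assms(2)] hom_mult[OF assms(2)] hom_in_carrier[OF assms(3)] hom_mult[OF assms(3)]
  by (intro biadditiveI)
    (simp_all add: biadditive_closed[OF assms(1)] biadditive_left[OF assms(1)] biadditive_right[OF assms(1)])

text \<open>Distributivity of the integers; it makes the right-hand sides of the two coefficient
  formulas biadditive.\<close>

lemma biadditive_integer_mult:
  assumes "f \<in> hom (add_monoid R) integer_group" "g \<in> hom (add_monoid S) integer_group"
  shows "biadditive R S integer_group (\<lambda>a b. f a * g b)"
  using hom_mult[OF assms(1)] hom_mult[OF assms(2)]
  by (intro biadditiveI) (simp_all add: algebra_simps)

context
  fixes R :: "('u, 'm) ring_scheme" and S :: "('v, 'n) ring_scheme"
  assumes R: "abelian_group R" and S: "abelian_group S"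
begin

interpretation R: abelian_group R by (rule R)
interpretation S: abelian_group S by (rule S)

abbreviation (input) "pairs \<equiv> free_Abelian_group (carrier R \<times> carrier S)"

interpretation pairs: comm_group pairs by (rule abelian_free_Abelian_group)

lemma tensor_relations_subset: "tensor_relations R S \<subseteq> carrier pairs"
proof -
  have "frag_of p - frag_of q - frag_of r \<in> carrier pairs"
    if "p \<in> carrier R \<times> carrier S" "q \<in> carrier R \<times> carrier S" "r \<in> carrier R \<times> carrier S" for p q r
    using that keys_diff[of "frag_of p - frag_of q" "frag_of r"] keys_diff[of "frag_of p" "frag_of q"]
    by auto
  then show ?thesis by (auto simp: tensor_relations_def simp del: carrier_free_Abelian_group_iff)
qed

lemma tensor_kernel_normal: "tensor_kernel R S \<lhd> pairs"
  unfolding pairs.normal_iff_subgroup tensor_kernel_def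
  by (rule pairs.generate_is_subgroup[OF tensor_relations_subset])

interpretation ker: normal "tensor_kernel R S" pairs by (rule tensor_kernel_normal)

lemma int_tensor_group: "group (int_tensor R S)"
  unfolding int_tensor_def by (rule ker.factorgroup_is_group)

lemma tensor_coset_hom: "(\<lambda>x. tensor_kernel R S #>\<^bsub>pairs\<^esub> x) \<in> hom pairs (int_tensor R S)"
  unfolding int_tensor_def by (rule ker.r_coset_hom_Mod)

text \<open>The group operation on \<open>pairs\<close> is addition, so adding \<open>y\<close> to
  the relation \<open>x - y\<close> gives back \<open>x\<close> and places it in the coset of
  \<open>y\<close>.\<close>

lemma tensor_coset_eqI:
  assumes "x - y \<in> tensor_relations R S" "y \<in> carrier pairs"
  shows "tensor_kernel R S #>\<^bsub>pairs\<^esub> x = tensor_kernel R S #>\<^bsub>pairs\<^esub> y"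
proof -
  have "x - y \<in> tensor_kernel R S"
    unfolding tensor_kernel_def using assms(1) by (rule generate.incl)
  then have "(x - y) \<otimes>\<^bsub>pairs\<^esub> y \<in> tensor_kernel R S #>\<^bsub>pairs\<^esub> y"
    unfolding r_coset_def by blast
  then show ?thesis
    using pairs.repr_independence[OF _ assms(2) ker.subgroup_axioms, of x] by simp
qed

text \<open>Each of the two families in \<open>tensor_relations\<close> gives additivity in one
  argument.\<close>

lemma pure_tensor_biadditive: "biadditive R S (int_tensor R S) (pure_tensor R S)"
proof (rule biadditiveI)
  fix a b assume "a \<in> carrier R" "b \<in> carrier S"
  then show "pure_tensor R S a b \<in> carrier (int_tensor R S)"
    unfolding pure_tensor_def by (intro hom_in_carrier[OF tensor_coset_hom]) simp
next
  fix a a' b assume car: "a \<in> carrier R" "a' \<in> carrier R" "b \<in> carrier S"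
  let ?y = "frag_of (a, b) \<otimes>\<^bsub>pairs\<^esub> frag_of (a', b)"
  have "?y \<in> carrier pairs" using car by (intro pairs.m_closed) auto
  moreover have "frag_of (a \<oplus>\<^bsub>R\<^esub> a', b) - ?y \<in> tensor_relations R S"
    using car unfolding tensor_relations_def by (auto simp: algebra_simps)
  ultimately have "pure_tensor R S (a \<oplus>\<^bsub>R\<^esub> a') b = tensor_kernel R S #>\<^bsub>pairs\<^esub> ?y"
    unfolding pure_tensor_def by (intro tensor_coset_eqI)
  also have "\<dots> = pure_tensor R S a b \<otimes>\<^bsub>int_tensor R S\<^esub> pure_tensor R S a' b"
    unfolding pure_tensor_def using car by (intro hom_mult[OF tensor_coset_hom]) auto
  finally show "pure_tensor R S (a \<oplus>\<^bsub>R\<^esub> a') b =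
    pure_tensor R S a b \<otimes>\<^bsub>int_tensor R S\<^esub> pure_tensor R S a' b" .
next
  fix a b b' assume car: "a \<in> carrier R" "b \<in> carrier S" "b' \<in> carrier S"
  let ?y = "frag_of (a, b) \<otimes>\<^bsub>pairs\<^esub> frag_of (a, b')"
  have "?y \<in> carrier pairs" using car by (intro pairs.m_closed) auto
  moreover have "frag_of (a, b \<oplus>\<^bsub>S\<^esub> b') - ?y \<in> tensor_relations R S"
    using car unfolding tensor_relations_def by (auto simp: algebra_simps)
  ultimately have "pure_tensor R S a (b \<oplus>\<^bsub>S\<^esub> b') = tensor_kernel R S #>\<^bsub>pairs\<^esub> ?y"
    unfolding pure_tensor_def by (intro tensor_coset_eqI)
  also have "\<dots> = pure_tensor R S a b \<otimes>\<^bsub>int_tensor R S\<^esub> pure_tensor R S a b'"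
    unfolding pure_tensor_def using car by (intro hom_mult[OF tensor_coset_hom]) auto
  finally show "pure_tensor R S a (b \<oplus>\<^bsub>S\<^esub> b') =
    pure_tensor R S a b \<otimes>\<^bsub>int_tensor R S\<^esub> pure_tensor R S a b'" .
qed

text \<open>The biadditive map extends freely to formal combinations of pairs. Biadditivity says
  exactly that this extension kills the relations, so it descends to the quotient.\<close>

lemma int_tensor_universal:
  assumes "comm_group M" and \<beta>: "biadditive R S M \<beta>"
  obtains P where "P \<in> hom (int_tensor R S) M"
    "\<And>a b. a \<in> carrier R \<Longrightarrow> b \<in> carrier S \<Longrightarrow> P (pure_tensor R S a b) = \<beta> a b"
proof -
  interpret M: comm_group M by fact
  have "(\<lambda>(a, b). \<beta> a b) ` (carrier R \<times> carrier S) \<subseteq> carrier M"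
    using biadditive_closed[OF \<beta>] by auto
  then obtain h where h: "h \<in> hom pairs M"
    and h_of: "\<And>p. p \<in> carrier R \<times> carrier S \<Longrightarrow> h (frag_of p) = (case p of (a, b) \<Rightarrow> \<beta> a b)"
    by (rule M.free_Abelian_group_universal) blast
  interpret h: group_hom pairs M h
    using h by (simp add: group_hom_def group_hom_axioms_def)
  \<comment> \<open>The relations are written with subtraction of formal combinations; in terms of
    product and inverse the homomorphism laws apply.\<close>
  have h_diff: "h (frag_of p - frag_of q - frag_of r) =
      h (frag_of p) \<otimes>\<^bsub>M\<^esub> inv\<^bsub>M\<^esub> h (frag_of q) \<otimes>\<^bsub>M\<^esub> inv\<^bsub>M\<^esub> h (frag_of r)"
    if p: "p \<in> carrier R \<times> carrier S" and q: "q \<in> carrier R \<times> carrier S" and r: "r \<in> carrier R \<times> carrier S"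
    for p q r
  proof -
    have car: "frag_of p \<in> carrier pairs" "frag_of q \<in> carrier pairs" "frag_of r \<in> carrier pairs"
      using p q r by (simp_all only: frag_of_in_free_Abelian_group)
    have "frag_of p - frag_of q - frag_of r =
        frag_of p \<otimes>\<^bsub>pairs\<^esub> inv\<^bsub>pairs\<^esub> frag_of q \<otimes>\<^bsub>pairs\<^esub> inv\<^bsub>pairs\<^esub> frag_of r"
      using q r by simp
    then show ?thesis using car by (simp only: h.hom_mult h.hom_inv pairs.m_closed pairs.inv_closed)
  qed
  have cancel: "x \<otimes>\<^bsub>M\<^esub> y \<otimes>\<^bsub>M\<^esub> inv\<^bsub>M\<^esub> x \<otimes>\<^bsub>M\<^esub> inv\<^bsub>M\<^esub> y = \<one>\<^bsub>M\<^esub>"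
    if "x \<in> carrier M" "y \<in> carrier M" for x y
    using that M.r_inv[of "x \<otimes>\<^bsub>M\<^esub> y"] by (simp add: M.inv_mult M.m_assoc del: M.r_inv)
  have "tensor_relations R S \<subseteq> kernel pairs M h"
  proof
    fix z assume z: "z \<in> tensor_relations R S"
    have "h z = \<one>\<^bsub>M\<^esub>"
      using z unfolding tensor_relations_def
      by (auto simp: h_diff h_of biadditive_left[OF \<beta>] biadditive_right[OF \<beta>]
          biadditive_closed[OF \<beta>] cancel)
    then show "z \<in> kernel pairs M h"
      using z tensor_relations_subset unfolding kernel_def by blast
  qed
  \<comment> \<open>A kernel is a subgroup, so it is enough that it contains the generators.\<close>
  then have ker: "tensor_kernel R S \<subseteq> kernel pairs M h"
    unfolding tensor_kernel_def by (rule pairs.generate_subgroup_incl[OF _ h.subgroup_kernel])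
  \<comment> \<open>Constancy on cosets is the form in which \<open>FactGroup_universal\<close>
    wants the kernel condition.\<close>
  have "h x = h y" if xy: "x \<in> carrier pairs" "y \<in> carrier pairs"
    "tensor_kernel R S #>\<^bsub>pairs\<^esub> x = tensor_kernel R S #>\<^bsub>pairs\<^esub> y" for x y
  proof -
    have "x \<in> tensor_kernel R S #>\<^bsub>pairs\<^esub> y"
      using pairs.rcos_self[OF xy(1) ker.subgroup_axioms] xy(3) by simp
    then obtain k where k: "k \<in> tensor_kernel R S" "x = k \<otimes>\<^bsub>pairs\<^esub> y" by (auto simp: r_coset_def)
    then have "k \<in> carrier pairs" "h k = \<one>\<^bsub>M\<^esub>" using ker unfolding kernel_def by blast+
    then show ?thesis unfolding k(2) using xy(2) by (simp only: h.hom_mult h.hom_closed M.l_one)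
  qed
  then obtain P where P: "P \<in> hom (int_tensor R S) M"
    "\<And>x. x \<in> carrier pairs \<Longrightarrow> P (tensor_kernel R S #>\<^bsub>pairs\<^esub> x) = h x"
    using FactGroup_universal[OF h tensor_kernel_normal] unfolding int_tensor_def by metis
  have "P (pure_tensor R S a b) = \<beta> a b" if "a \<in> carrier R" "b \<in> carrier S" for a b
    using that by (simp add: pure_tensor_def P(2) h_of)
  then show ?thesis using that P(1) by blast
qed

text \<open>Composed with the quotient map, both become homomorphisms on the free abelian group,
  where agreement on the basis of pairs propagates through differences.\<close>

lemma int_tensor_hom_eq:
  assumes "group M" and P: "P \<in> hom (int_tensor R S) M" and Q: "Q \<in> hom (int_tensor R S) M"
    and eq: "\<And>a b. a \<in> carrier R \<Longrightarrow> b \<in> carrier S \<Longrightarrow>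
      P (pure_tensor R S a b) = Q (pure_tensor R S a b)"
    and z: "z \<in> carrier (int_tensor R S)"
  shows "P z = Q z"
proof -
  let ?c = "\<lambda>x. tensor_kernel R S #>\<^bsub>pairs\<^esub> x"
  interpret Pc: group_hom pairs M "\<lambda>x. P (?c x)"
    using hom_compose[OF tensor_coset_hom P] \<open>group M\<close>
    by (simp add: group_hom_def group_hom_axioms_def comp_def)
  interpret Qc: group_hom pairs M "\<lambda>x. Q (?c x)"
    using hom_compose[OF tensor_coset_hom Q] \<open>group M\<close>
    by (simp add: group_hom_def group_hom_axioms_def comp_def)
  obtain x where x: "x \<in> carrier pairs" "z = ?c x"
    using z by (auto simp: int_tensor_def carrier_FactGroup)
  have "Poly_Mapping.keys x \<subseteq> carrier R \<times> carrier S" using x(1) by simp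
  then have "P (?c x) = Q (?c x)"
  proof (rule free_Abelian_group_induct[where P = "\<lambda>x. P (?c x) = Q (?c x)"])
    show "P (?c 0) = Q (?c 0)" using Pc.hom_one Qc.hom_one by simp
  next
    fix x y
    assume xy: "Poly_Mapping.keys x \<subseteq> carrier R \<times> carrier S" "Poly_Mapping.keys y \<subseteq> carrier R \<times> carrier S"
      and eqs: "P (?c x) = Q (?c x)" "P (?c y) = Q (?c y)"
    then have car: "x \<in> carrier pairs" "y \<in> carrier pairs" by simp_all
    have "x - y = x \<otimes>\<^bsub>pairs\<^esub> inv\<^bsub>pairs\<^esub> y" using xy by simp
    then show "P (?c (x - y)) = Q (?c (x - y))"
      using car eqs by (simp only: Pc.hom_mult Qc.hom_mult Pc.hom_inv Qc.hom_inv pairs.inv_closed)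
  next
    fix p assume "p \<in> carrier R \<times> carrier S"
    then show "P (?c (frag_of p)) = Q (?c (frag_of p))"
      using eq[of "fst p" "snd p"] by (auto simp: pure_tensor_def)
  qed
  then show ?thesis using x(2) by simp
qed

end

section \<open>Normal cores and products\<close>

context group
begin

lemma mem_normal_core_iff:
  assumes "H \<subseteq> carrier G"
  shows "x \<in> normal_core G H \<longleftrightarrow> x \<in> carrier G \<and> (\<forall>g\<in>carrier G. inv g \<otimes> x \<otimes> g \<in> H)"
proof -
  have "x \<in> carrier G" if "x \<in> normal_core G H"
  proof -
    \<comment> \<open>One of the intersected conjugates, the one by the unit, already confines the
      core to the carrier.\<close>
    have "x \<in> \<one> <# H #> inv \<one>" using that unfolding normal_core_def by blast
    moreover have "\<one> <# H #> inv \<one> \<subseteq> carrier G"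
      using assms by (simp add: l_coset_subset_G r_coset_subset_G del: inv_one)
    ultimately show ?thesis by blast
  qed
  then show ?thesis using mem_conj_iff[OF assms] unfolding normal_core_def by blast
qed

lemma normal_core_normal:
  assumes "subgroup H G"
  shows "normal_core G H \<lhd> G"
  unfolding normal_inv_iff
proof (intro conjI ballI)
  note core = mem_normal_core_iff[OF subgroup.subset[OF assms]]
  show "subgroup (normal_core G H) G"
    unfolding normal_core_def
    by (rule subgroups_Inter) (use subgroup_conjugation_is_surj2[OF _ assms] in auto)
  fix x h assume x: "x \<in> carrier G" and h: "h \<in> normal_core G H"
  have "inv g \<otimes> (x \<otimes> h \<otimes> inv x) \<otimes> g \<in> H" if g: "g \<in> carrier G" for g
  proof -
    \<comment> \<open>Conjugating by \<open>x\<close> and then back by \<open>g\<close> is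
      conjugating back by \<open>inv x \<otimes> g\<close>, and the condition on \<open>h\<close>
      holds for every group element.\<close>
    have "inv (inv x \<otimes> g) \<otimes> h \<otimes> (inv x \<otimes> g) \<in> H" using h x g core by blast
    then show ?thesis using x g h core by (simp add: inv_mult_group m_assoc)
  qed
  then show "x \<otimes> h \<otimes> inv x \<in> normal_core G H" using core x h by simp
qed

lemma normal_core_subgroup: "subgroup H G \<Longrightarrow> subgroup (normal_core G H) G"
  using normal_core_normal normal_imp_subgroup by blast

text \<open>Replacing \<open>H\<close> by its conjugate under \<open>a\<close> only reindexes the
  intersection by g \<mapsto> ga, a permutation of the group.\<close>

lemma normal_core_conj:
  assumes H: "subgroup H G" and H': "H' \<in> subgroup_conj_class G H"
  shows "normal_core G H' = normal_core G H"
proof -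
  obtain a where a: "a \<in> carrier G" "H' = a <# H #> inv a"
    using H' by (auto simp: subgroup_conj_class_def)
  note sub = subgroup.subset[OF H] subgroup.subset[OF subgroup_conj_class_subgroup[OF H H']]
  have iff: "(\<forall>g\<in>carrier G. inv g \<otimes> x \<otimes> g \<in> H') \<longleftrightarrow> (\<forall>g\<in>carrier G. inv g \<otimes> x \<otimes> g \<in> H)"
    if x: "x \<in> carrier G" for x
  proof -
    have H'_iff: "inv g \<otimes> x \<otimes> g \<in> H' \<longleftrightarrow> inv (g \<otimes> a) \<otimes> x \<otimes> (g \<otimes> a) \<in> H" if "g \<in> carrier G" for g
      unfolding a(2) using that x a by (simp add: mem_conj_iff[OF sub(1)] inv_mult_group m_assoc)
    show ?thesis
    proof (intro iffI ballI)
      fix g assume all: "\<forall>g\<in>carrier G. inv g \<otimes> x \<otimes> g \<in> H'" and g: "g \<in> carrier G"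
      \<comment> \<open>Surjectivity of the reindexing: \<open>g\<close> is reached from
        \<open>g \<otimes> inv a\<close>.\<close>
      have "g \<otimes> inv a \<otimes> a = g" using g a by (simp add: m_assoc)
      then show "inv g \<otimes> x \<otimes> g \<in> H" using H'_iff[of "g \<otimes> inv a"] all g a by simp
    qed (use H'_iff a in simp)
  qed
  show ?thesis
    by (rule Set.set_eqI)
      (simp add: mem_normal_core_iff[OF sub(1)] mem_normal_core_iff[OF sub(2)] iff cong: conj_cong)
qed

end

text \<open>Conjugation in the product is componentwise, so the condition at a pair of conjugating
  elements is one condition for each factor.\<close>

lemma normal_core_DirProd:
  assumes "group G1" "group G2" "subgroup H1 G1" "subgroup H2 G2"
  shows "normal_core (G1 \<times>\<times> G2) (H1 \<times> H2) = normal_core G1 H1 \<times> normal_core G2 H2"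
proof -
  interpret G1: group G1 by fact
  interpret G2: group G2 by fact
  interpret P: group "G1 \<times>\<times> G2" by (rule DirProd_group[OF assms(1,2)])
  note sub = subgroup.subset[OF assms(3)] subgroup.subset[OF assms(4)]
  note subP = subgroup.subset[OF DirProd_subgroups[OF assms(1,3,2,4)]]
  show ?thesis
  proof (rule Set.set_eqI, clarify)
    fix x y
    \<comment> \<open>The units show that both carriers are inhabited, which allows the quantifier
      over pairs to split into two independent ones.\<close>
    have "(\<forall>g\<in>carrier (G1 \<times>\<times> G2). inv\<^bsub>G1 \<times>\<times> G2\<^esub> g \<otimes>\<^bsub>G1 \<times>\<times> G2\<^esub> (x, y) \<otimes>\<^bsub>G1 \<times>\<times> G2\<^esub> g \<in> H1 \<times> H2) \<longleftrightarrow>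
        (\<forall>g\<in>carrier G1. inv\<^bsub>G1\<^esub> g \<otimes>\<^bsub>G1\<^esub> x \<otimes>\<^bsub>G1\<^esub> g \<in> H1) \<and>
        (\<forall>g\<in>carrier G2. inv\<^bsub>G2\<^esub> g \<otimes>\<^bsub>G2\<^esub> y \<otimes>\<^bsub>G2\<^esub> g \<in> H2)"
      using G1.one_closed G2.one_closed by (auto simp: assms(1,2))
    then show "(x, y) \<in> normal_core (G1 \<times>\<times> G2) (H1 \<times> H2) \<longleftrightarrow>
        (x, y) \<in> normal_core G1 H1 \<times> normal_core G2 H2"
      unfolding P.mem_normal_core_iff[OF subP] mem_Sigma_iff
        G1.mem_normal_core_iff[OF sub(1)] G2.mem_normal_core_iff[OF sub(2)] by auto
  qed
qed

text \<open>Conjugation by the pair of conjugating elements. This makes the value prescribed for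
  \<open>burnside_Prod\<close> independent of the representatives in both factors.\<close>

lemma subgroup_conj_class_DirProd:
  assumes "group G1" "group G2" "H1' \<in> subgroup_conj_class G1 H1" "H2' \<in> subgroup_conj_class G2 H2"
  shows "H1' \<times> H2' \<in> subgroup_conj_class (G1 \<times>\<times> G2) (H1 \<times> H2)"
proof -
  obtain a b where a: "a \<in> carrier G1" "H1' = a <#\<^bsub>G1\<^esub> H1 #>\<^bsub>G1\<^esub> inv\<^bsub>G1\<^esub> a"
    and b: "b \<in> carrier G2" "H2' = b <#\<^bsub>G2\<^esub> H2 #>\<^bsub>G2\<^esub> inv\<^bsub>G2\<^esub> b"
    using assms(3,4) by (auto simp: subgroup_conj_class_def)
  have "H1' \<times> H2' = (a, b) <#\<^bsub>G1 \<times>\<times> G2\<^esub> (H1 \<times> H2) #>\<^bsub>G1 \<times>\<times> G2\<^esub> inv\<^bsub>G1 \<times>\<times> G2\<^esub> (a, b)"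
    using a b assms(1,2) by (auto simp: l_coset_def r_coset_def)
  then show ?thesis using a b unfolding subgroup_conj_class_def by auto
qed

section \<open>Compression and core coefficients on the basis\<close>

context finite_group
begin

text \<open>The prescribed values are constant on conjugacy classes by
  \<open>normal_core_conj\<close>, so the linear extension has them; restricting it to the carrier
  meets the extensionality demanded by the description. Uniqueness is
  \<open>burnside_hom_eq\<close>.\<close>

lemma normal_core_compression:
  "normal_core_compression G \<in> hom (add_monoid (burnside_ring G)) (add_monoid (burnside_ring G))"
  "subgroup H G \<Longrightarrow>
    normal_core_compression G (transitive_gset G H) = transitive_gset G (normal_core G H)"
proof -
  let ?B = "burnside_ring G"
  let ?Q = "\<lambda>f. f \<in> hom (add_monoid ?B) (add_monoid ?B) \<and> f \<in> extensional (carrier ?B) \<and>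
    (\<forall>H. subgroup H G \<longrightarrow> f (transitive_gset G H) = transitive_gset G (normal_core G H))"
  let ?t = "\<lambda>H. transitive_gset G (normal_core G H)"
  have t: "?t H \<in> carrier ?B" if "subgroup H G" for H
    using that by (intro transitive_gset_closed normal_core_subgroup)
  define f where "f = restrict (linear_extension G ?B ?t) (carrier ?B)"
  have hom: "f \<in> hom (add_monoid ?B) (add_monoid ?B)"
    using linear_extension_hom[where t = ?t, OF burnside.abelian_group_axioms t]
    by (simp add: f_def hom_def Pi_def)
  have "?Q f"
    using hom linear_extension_transitive[where t = ?t, OF burnside.abelian_group_axioms t]
    by (simp add: f_def transitive_gset_closed normal_core_conj)
  moreover have "h = f" if "?Q h" for h
    using that \<open>?Q f\<close> burnside_hom_eq[OF burnside.a_group, of h f]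
    by (intro extensionalityI[of h "carrier ?B"]) auto
  ultimately have Q: "?Q (normal_core_compression G)"
    unfolding normal_core_compression_def by (rule theI)
  show "normal_core_compression G \<in> hom (add_monoid ?B) (add_monoid ?B)"
    "subgroup H G \<Longrightarrow> normal_core_compression G (transitive_gset G H) = transitive_gset G (normal_core G H)"
    by (simp_all only: Q)
qed

lemma core_coeff_hom: "core_coeff G N \<in> hom (add_monoid (burnside_ring G)) integer_group"
proof (rule homI)
  fix x y assume "x \<in> carrier (add_monoid (burnside_ring G))" "y \<in> carrier (add_monoid (burnside_ring G))"
  then show "core_coeff G N (x \<otimes>\<^bsub>add_monoid (burnside_ring G)\<^esub> y) =
      core_coeff G N x \<otimes>\<^bsub>integer_group\<^esub> core_coeff G N y"
    by (simp add: core_coeff_def burnside_coeffs_add sum.distrib)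
qed simp

text \<open>Only the class of \<open>H\<close> has a nonzero coefficient. Conjugate subgroups share
  their core, so that class is among the summands exactly when the core of \<open>H\<close> is
  \<open>N\<close>.\<close>

lemma core_coeff_transitive:
  assumes H: "subgroup H G"
  shows "core_coeff G N (transitive_gset G H) = (if normal_core G H = N then 1 else 0)"
proof -
  let ?K = "{K \<in> subgroup_conj_classes G. \<exists>H\<in>K. normal_core G H = N}"
  have "core_coeff G N (transitive_gset G H) = (\<Sum>K\<in>?K. if K = subgroup_conj_class G H then 1 else 0)"
    unfolding core_coeff_def by (rule sum.cong) (auto simp: burnside_coeffs_transitive[OF H])
  also have "\<dots> = (if subgroup_conj_class G H \<in> ?K then 1 else 0)"
    using finite_conj_classes by simp
  also have "subgroup_conj_class G H \<in> ?K \<longleftrightarrow> normal_core G H = N"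
  proof
    assume "subgroup_conj_class G H \<in> ?K"
    then obtain H' where "H' \<in> subgroup_conj_class G H" "normal_core G H' = N" by blast
    then show "normal_core G H = N" using normal_core_conj[OF H] by simp
  qed (use conj_class_in_classes[OF H] subgroup_conj_class_self[OF H] in blast)
  finally show ?thesis .
qed

lemma core_coeff_sum_hom: "core_coeff_sum G N \<in> hom (add_monoid (burnside_ring G)) integer_group"
  using hom_mult[OF core_coeff_hom] by (intro homI) (simp_all add: core_coeff_sum_def sum.distrib)

text \<open>Exactly one M can contribute, the core of \<open>H\<close>. It is normal, so it occurs
  in the sum as soon as it contains \<open>N\<close>.\<close>

lemma core_coeff_sum_transitive:
  assumes H: "subgroup H G"
  shows "core_coeff_sum G N (transitive_gset G H) = (if N \<subseteq> normal_core G H then 1 else 0)"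
proof -
  have "{M. N \<subseteq> M \<and> M \<lhd> G} \<subseteq> Pow (carrier G)"
    using normal_imp_subgroup subgroup.subset by blast
  then have "finite {M. N \<subseteq> M \<and> M \<lhd> G}" using finite_carrier finite_subset by blast
  then show ?thesis
    using normal_core_normal[OF H] by (simp add: core_coeff_sum_def core_coeff_transitive[OF H])
qed

end

section \<open>Two groups and the product map\<close>

locale finite_group_pair = G1: finite_group G1 + G2: finite_group G2
  for G1 :: "('a, 'm) monoid_scheme" and G2 :: "('b, 'n) monoid_scheme"

sublocale finite_group_pair \<subseteq> G12: finite_group "G1 \<times>\<times> G2"
  using DirProd_group[OF G1.is_group G2.is_group] G1.finite_carrier G2.finite_carrier
  by (simp add: finite_group_def finite_group_axioms_def)

context finite_group_pair
begin

abbreviation "B1 \<equiv> burnside_ring G1"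
abbreviation "B2 \<equiv> burnside_ring G2"
abbreviation "B12 \<equiv> burnside_ring (G1 \<times>\<times> G2)"

lemma subgroup_Times: "subgroup H1 G1 \<Longrightarrow> subgroup H2 G2 \<Longrightarrow> subgroup (H1 \<times> H2) (G1 \<times>\<times> G2)"
  using DirProd_subgroups G1.is_group G2.is_group by blast

text \<open>Agreement on generators, used first in \<open>x\<close> with \<open>y\<close> fixed and
  then in \<open>y\<close> at each [G1/H1]. All three identities of the theorem, and the uniqueness
  of \<open>burnside_Prod\<close>, are reduced to transitive sets by it.\<close>

lemma biadditive_burnside_eq:
  assumes M: "group M" and \<beta>: "biadditive B1 B2 M \<beta>" and \<gamma>: "biadditive B1 B2 M \<gamma>"
    and eq: "\<And>H1 H2. subgroup H1 G1 \<Longrightarrow> subgroup H2 G2 \<Longrightarrow>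
      \<beta> (transitive_gset G1 H1) (transitive_gset G2 H2) = \<gamma> (transitive_gset G1 H1) (transitive_gset G2 H2)"
    and x: "x \<in> carrier B1" and y: "y \<in> carrier B2"
  shows "\<beta> x y = \<gamma> x y"
proof (rule G1.burnside_hom_eq[OF M _ _ _ x])
  show "(\<lambda>x. \<beta> x y) \<in> hom (add_monoid B1) M" "(\<lambda>x. \<gamma> x y) \<in> hom (add_monoid B1) M"
    using \<beta> \<gamma> y by (auto simp: biadditive_def)
  fix H1 assume H1: "subgroup H1 G1"
  have "\<beta> (transitive_gset G1 H1) \<in> hom (add_monoid B2) M" "\<gamma> (transitive_gset G1 H1) \<in> hom (add_monoid B2) M"
    using \<beta> \<gamma> G1.transitive_gset_closed[OF H1] by (auto simp: biadditive_def)
  then show "\<beta> (transitive_gset G1 H1) y = \<gamma> (transitive_gset G1 H1) y"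
    by (rule G2.burnside_hom_eq[OF M _ _ _ y]) (rule eq[OF H1])
qed

text \<open>Linear extension is nested: \<open>s\<close> extends the prescribed values in the second
  variable, and \<open>\<beta>\<close> extends \<open>s\<close> in the first.\<close>

lemma ex_biadditive_product:
  obtains \<beta> where "biadditive B1 B2 (add_monoid B12) \<beta>"
    "\<And>H1 H2. subgroup H1 G1 \<Longrightarrow> subgroup H2 G2 \<Longrightarrow>
      \<beta> (transitive_gset G1 H1) (transitive_gset G2 H2) = transitive_gset (G1 \<times>\<times> G2) (H1 \<times> H2)"
proof -
  note ab = G12.burnside.abelian_group_axioms
  define t where "t = (\<lambda>H1 H2. transitive_gset (G1 \<times>\<times> G2) (H1 \<times> H2))"
  define s where "s = (\<lambda>y H1. linear_extension G2 B12 (t H1) y)"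
  define \<beta> where "\<beta> = (\<lambda>x y. linear_extension G1 B12 (s y) x)"
  have t: "t H1 H2 \<in> carrier B12" if "subgroup H1 G1" "subgroup H2 G2" for H1 H2
    using that by (simp add: t_def G12.transitive_gset_closed subgroup_Times)
  have t_conj: "t H1' H2' = t H1 H2" if "subgroup H1 G1" "subgroup H2 G2"
    "H1' \<in> subgroup_conj_class G1 H1" "H2' \<in> subgroup_conj_class G2 H2" for H1 H2 H1' H2'
    unfolding t_def using that
    by (intro G12.transitive_gset_conj subgroup_Times subgroup_conj_class_DirProd G1.is_group G2.is_group)
  have s: "s y H1 \<in> carrier B12" if "subgroup H1 G1" for y H1
    unfolding s_def by (rule G2.linear_extension_closed[OF ab]) (rule t[OF that])
  have hom2: "linear_extension G2 B12 (t H1) \<in> hom (add_monoid B2) (add_monoid B12)"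
    if "subgroup H1 G1" for H1
    by (rule G2.linear_extension_hom[OF ab]) (rule t[OF that])
  have hom1: "linear_extension G1 B12 (s y) \<in> hom (add_monoid B1) (add_monoid B12)" for y
    by (rule G1.linear_extension_hom[OF ab]) (rule s)
  have s_add: "s (y \<oplus>\<^bsub>B2\<^esub> y') H1 = s y H1 \<oplus>\<^bsub>B12\<^esub> s y' H1"
    if "subgroup H1 G1" "y \<in> carrier B2" "y' \<in> carrier B2" for y y' H1
    using hom_mult[OF hom2[OF that(1)], of y y'] that by (simp add: s_def)
  have "biadditive B1 B2 (add_monoid B12) \<beta>"
  proof (rule biadditiveI)
    fix x y show "\<beta> x y \<in> carrier (add_monoid B12)"
      unfolding \<beta>_def using G1.linear_extension_closed[where t = "s y", OF ab s] by simp
  next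
    fix x x' y assume "x \<in> carrier B1" "x' \<in> carrier B1"
    then show "\<beta> (x \<oplus>\<^bsub>B1\<^esub> x') y = \<beta> x y \<otimes>\<^bsub>add_monoid B12\<^esub> \<beta> x' y"
      using hom_mult[OF hom1, of x x'] by (simp add: \<beta>_def)
  next
    fix x y y' assume y: "y \<in> carrier B2" "y' \<in> carrier B2"
    \<comment> \<open>For fixed \<open>x\<close> the coefficients of the outer sum stay the same, so
      additivity in \<open>y\<close> is additivity of the outer extension in its prescribed
      values.\<close>
    have "\<beta> x (y \<oplus>\<^bsub>B2\<^esub> y') = linear_extension G1 B12 (\<lambda>H. s y H \<oplus>\<^bsub>B12\<^esub> s y' H) x"
      unfolding \<beta>_def linear_extension_def
      by (rule G12.burnside.finsum_cong')
        (use y s_add s G12.burnside.add_pow_closed G1.representative_subgroup in auto)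
    also have "\<dots> = \<beta> x y \<oplus>\<^bsub>B12\<^esub> \<beta> x y'"
      unfolding \<beta>_def by (rule G1.linear_extension_add[OF ab]) (rule s, assumption)+
    finally show "\<beta> x (y \<oplus>\<^bsub>B2\<^esub> y') = \<beta> x y \<otimes>\<^bsub>add_monoid B12\<^esub> \<beta> x y'" by simp
  qed
  moreover have "\<beta> (transitive_gset G1 H1) (transitive_gset G2 H2) = transitive_gset (G1 \<times>\<times> G2) (H1 \<times> H2)"
    if H: "subgroup H1 G1" "subgroup H2 G2" for H1 H2
  proof -
    \<comment> \<open>The outer extension is determined at [G1/H1] only if the inner values are
      constant along the class of \<open>H1\<close>; they inherit this from
      \<open>t\<close>.\<close>
    have s_t: "s (transitive_gset G2 H2) H1' = t H1 H2" if H1': "H1' \<in> subgroup_conj_class G1 H1" for H1'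
    proof -
      have sub: "subgroup H1' G1" by (rule G1.subgroup_conj_class_subgroup[OF H(1) H1'])
      have "s (transitive_gset G2 H2) H1' = t H1' H2"
        unfolding s_def
        by (rule G2.linear_extension_transitive[OF ab _ H(2)])
          (use t[OF sub] t_conj[OF sub H(2) G1.subgroup_conj_class_self[OF sub]] in simp_all)
      also have "\<dots> = t H1 H2" by (rule t_conj[OF H H1' G2.subgroup_conj_class_self[OF H(2)]])
      finally show ?thesis .
    qed
    have "\<beta> (transitive_gset G1 H1) (transitive_gset G2 H2) = s (transitive_gset G2 H2) H1"
      unfolding \<beta>_def
      by (rule G1.linear_extension_transitive[OF ab _ H(1)])
        (simp_all add: s s_t G1.subgroup_conj_class_self[OF H(1)])
    then show ?thesis using s_t[OF G1.subgroup_conj_class_self[OF H(1)]] by (simp add: t_def)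
  qed
  ultimately show ?thesis using that by blast
qed

text \<open>The universal property turns the biadditive product into a candidate. For uniqueness,
  two candidates agree on tensors of transitive sets, then by biadditivity on all pure tensors, and
  these generate the tensor product.\<close>

lemma burnside_Prod:
  "burnside_Prod G1 G2 \<in> hom (int_tensor B1 B2) (add_monoid B12)"
  "subgroup H1 G1 \<Longrightarrow> subgroup H2 G2 \<Longrightarrow>
    burnside_Prod G1 G2 (burnside_tensor G1 G2 (transitive_gset G1 H1) (transitive_gset G2 H2)) =
    transitive_gset (G1 \<times>\<times> G2) (H1 \<times> H2)"
proof -
  note ab = G1.burnside.abelian_group_axioms G2.burnside.abelian_group_axioms
  let ?T = "int_tensor B1 B2"
  let ?Q = "\<lambda>P. P \<in> hom ?T (add_monoid B12) \<and> P \<in> extensional (carrier ?T) \<and>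
    (\<forall>H1 H2. subgroup H1 G1 \<longrightarrow> subgroup H2 G2 \<longrightarrow>
      P (burnside_tensor G1 G2 (transitive_gset G1 H1) (transitive_gset G2 H2)) =
      transitive_gset (G1 \<times>\<times> G2) (H1 \<times> H2))"
  note pure = pure_tensor_biadditive[OF ab]
  note T = int_tensor_group[OF ab]
  obtain \<beta> where \<beta>: "biadditive B1 B2 (add_monoid B12) \<beta>"
    "\<And>H1 H2. subgroup H1 G1 \<Longrightarrow> subgroup H2 G2 \<Longrightarrow>
      \<beta> (transitive_gset G1 H1) (transitive_gset G2 H2) = transitive_gset (G1 \<times>\<times> G2) (H1 \<times> H2)"
    by (rule ex_biadditive_product) blast
  obtain P where P: "P \<in> hom ?T (add_monoid B12)"
    "\<And>a b. a \<in> carrier B1 \<Longrightarrow> b \<in> carrier B2 \<Longrightarrow> P (pure_tensor B1 B2 a b) = \<beta> a b"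
    using int_tensor_universal[OF ab G12.burnside.a_comm_group \<beta>(1)] by blast
  define P' where "P' = restrict P (carrier ?T)"
  have "P' \<in> hom ?T (add_monoid B12)"
    using P(1) group.is_monoid[OF T] by (simp add: P'_def hom_def Pi_def monoid.m_closed)
  then have Q': "?Q P'"
    using \<beta>(2) P(2) biadditive_closed[OF pure]
    by (simp add: P'_def G1.transitive_gset_closed G2.transitive_gset_closed)
  moreover have "h = P'" if h: "?Q h" for h
  proof -
    have "h z = P' z" if z: "z \<in> carrier ?T" for z
    proof (rule int_tensor_hom_eq[OF ab G12.burnside.a_group conjunct1[OF h] conjunct1[OF Q'] _ z])
      fix a b assume "a \<in> carrier B1" "b \<in> carrier B2"
      then show "h (pure_tensor B1 B2 a b) = P' (pure_tensor B1 B2 a b)"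
        by (rule biadditive_burnside_eq[OF G12.burnside.a_group
              biadditive_compose[OF pure conjunct1[OF h]] biadditive_compose[OF pure conjunct1[OF Q']], rotated])
          (simp add: h Q')
    qed
    then show ?thesis using h Q' by (intro extensionalityI[of h "carrier ?T"]) simp_all
  qed
  ultimately have Q: "?Q (burnside_Prod G1 G2)"
    unfolding burnside_Prod_def by (rule theI)
  show "burnside_Prod G1 G2 \<in> hom (int_tensor B1 B2) (add_monoid B12)"
    "subgroup H1 G1 \<Longrightarrow> subgroup H2 G2 \<Longrightarrow>
      burnside_Prod G1 G2 (burnside_tensor G1 G2 (transitive_gset G1 H1) (transitive_gset G2 H2)) =
      transitive_gset (G1 \<times>\<times> G2) (H1 \<times> H2)"
    by (simp_all only: Q)
qed

text \<open>From here on the tensor product appears only through this biadditive map, to which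
  \<open>biadditive_burnside_eq\<close> applies.\<close>

lemma Prod_biadditive:
  "biadditive B1 B2 (add_monoid B12) (\<lambda>x y. burnside_Prod G1 G2 (burnside_tensor G1 G2 x y))"
  using biadditive_compose[OF pure_tensor_biadditive burnside_Prod(1)]
    G1.burnside.abelian_group_axioms G2.burnside.abelian_group_axioms by blast

lemma normal_core_Times:
  "subgroup H1 G1 \<Longrightarrow> subgroup H2 G2 \<Longrightarrow>
    normal_core (G1 \<times>\<times> G2) (H1 \<times> H2) = normal_core G1 H1 \<times> normal_core G2 H2"
  by (rule normal_core_DirProd[OF G1.is_group G2.is_group])

text \<open>On [G1/H1] and [G2/H2] both sides give the transitive set of
  \<open>normal_core G1 H1 \<times> normal_core G2 H2\<close>.\<close>

lemma normal_core_compression_Prod: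
  assumes "x \<in> carrier B1" "y \<in> carrier B2"
  shows "normal_core_compression (G1 \<times>\<times> G2) (burnside_Prod G1 G2 (burnside_tensor G1 G2 x y)) =
    burnside_Prod G1 G2
      (burnside_tensor G1 G2 (normal_core_compression G1 x) (normal_core_compression G2 y))"
  by (rule biadditive_burnside_eq[OF G12.burnside.a_group
        biadditive_compose[OF Prod_biadditive G12.normal_core_compression(1)]
        biadditive_compose_args[OF Prod_biadditive G1.normal_core_compression(1) G2.normal_core_compression(1)]
        _ assms])
    (simp add: burnside_Prod(2) G1.normal_core_compression(2) G2.normal_core_compression(2)
      G12.normal_core_compression(2) subgroup_Times normal_core_Times
      G1.normal_core_subgroup G2.normal_core_subgroup)

text \<open>On transitive sets both sides are indicators. An equality of products of sets splits
  into equalities of the factors because \<open>N1\<close> and \<open>N2\<close> are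
  nonempty.\<close>

lemma core_coeff_Prod:
  assumes "x \<in> carrier B1" "y \<in> carrier B2" "N1 \<noteq> {}" "N2 \<noteq> {}"
  shows "core_coeff (G1 \<times>\<times> G2) (N1 \<times> N2) (burnside_Prod G1 G2 (burnside_tensor G1 G2 x y)) =
    core_coeff G1 N1 x * core_coeff G2 N2 y"
  by (rule biadditive_burnside_eq[OF group_integer_group
        biadditive_compose[OF Prod_biadditive G12.core_coeff_hom]
        biadditive_integer_mult[OF G1.core_coeff_hom G2.core_coeff_hom] _ assms(1,2)])
    (use assms(3,4) in \<open>auto simp: burnside_Prod(2) G1.core_coeff_transitive G2.core_coeff_transitive
      G12.core_coeff_transitive subgroup_Times normal_core_Times times_eq_iff\<close>)

text \<open>The sum on the left runs over all normal subgroups of the product group above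
  \<open>N1 \<times> N2\<close>, which need not be products themselves. Evaluation on transitive
  sets avoids describing them: inclusion in a product of cores is tested factor by factor,
  \<open>N1\<close> and \<open>N2\<close> being nonempty.\<close>

lemma core_coeff_sum_Prod:
  assumes "x \<in> carrier B1" "y \<in> carrier B2" "N1 \<noteq> {}" "N2 \<noteq> {}"
  shows "core_coeff_sum (G1 \<times>\<times> G2) (N1 \<times> N2) (burnside_Prod G1 G2 (burnside_tensor G1 G2 x y)) =
    core_coeff_sum G1 N1 x * core_coeff_sum G2 N2 y"
  by (rule biadditive_burnside_eq[OF group_integer_group
        biadditive_compose[OF Prod_biadditive G12.core_coeff_sum_hom]
        biadditive_integer_mult[OF G1.core_coeff_sum_hom G2.core_coeff_sum_hom] _ assms(1,2)])
    (use assms(3,4) in \<open>auto simp: burnside_Prod(2) G1.core_coeff_sum_transitive G2.core_coeff_sum_transitive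
      G12.core_coeff_sum_transitive subgroup_Times normal_core_Times times_subset_iff\<close>)

end

theorem proposition5p3:
  fixes G1 :: "('a, 'm) monoid_scheme" and G2 :: "('b, 'n) monoid_scheme"
    and x1 :: "'a burnside" and x2 :: "'b burnside"
  assumes "group G1" and "finite (carrier G1)"
    and "group G2" and "finite (carrier G2)"
    and "x1 \<in> carrier (burnside_ring G1)" and "x2 \<in> carrier (burnside_ring G2)"
  shows "normal_core_compression (G1 \<times>\<times> G2) (burnside_Prod G1 G2 (burnside_tensor G1 G2 x1 x2)) =
           burnside_Prod G1 G2
             (burnside_tensor G1 G2 (normal_core_compression G1 x1) (normal_core_compression G2 x2)) \<and>
         (\<forall>N1 N2. N1 \<lhd> G1 \<longrightarrow> N2 \<lhd> G2 \<longrightarrow>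
           core_coeff (G1 \<times>\<times> G2) (N1 \<times> N2) (burnside_Prod G1 G2 (burnside_tensor G1 G2 x1 x2)) =
             core_coeff G1 N1 x1 * core_coeff G2 N2 x2 \<and>
           core_coeff_sum (G1 \<times>\<times> G2) (N1 \<times> N2) (burnside_Prod G1 G2 (burnside_tensor G1 G2 x1 x2)) =
             core_coeff_sum G1 N1 x1 * core_coeff_sum G2 N2 x2)"
proof -
  interpret finite_group_pair G1 G2
    using assms by (simp add: finite_group_pair_def finite_group_def finite_group_axioms_def)
  \<comment> \<open>Normal subgroups contain the unit, which supplies the nonemptiness that lets
    products of sets be compared factor by factor.\<close>
  have "N1 \<noteq> {}" if "N1 \<lhd> G1" for N1
    using subgroup.one_closed[OF normal_imp_subgroup[OF that]] by blast
  moreover have "N2 \<noteq> {}" if "N2 \<lhd> G2" for N2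
    using subgroup.one_closed[OF normal_imp_subgroup[OF that]] by blast
  ultimately show ?thesis
    using normal_core_compression_Prod core_coeff_Prod core_coeff_sum_Prod assms(5,6) by simp
qed

end
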